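(* Let $L = h_1\cup h_2$ be a two-component handlebody-link in $S^3$ whose components $h_1$ and $h_2$ have genera $m$ and $n$ respectively. Then $Lk(h_1,h_2)$ does not depend on the choice of the bases of $H_1(h_1)$ and $H_1(h_2)$ used to define it. Consequently $Lk(h_1,h_2)$ is an invariant of two-component handlebody-links: if $L=h_1\cup h_2$ and $L'=h_1'\cup h_2'$ are two-component handlebody-links in $S^3$ and there is an ambient isotopy of $S^3$ carrying $L$ onto $L'$, then $Lk(h_1,h_2)=Lk(h_1',h_2')$.
   Context: A handlebody-link is an embedding of a disjoint union of (3-dimensional) handlebodies into a 3-manifold, here $S^3$; embeddings are tame, so each handlebody-link is a regular neighborhood of a spatial graph. Handlebody-links are considered up to ambient isotopy. A two-component handlebody-link is $L=h_1\cup h_2$ with $h_1,h_2$ disjoint embedded handlebodies. Homology is with $\mathbb{Z}$ coefficients. Definition of $Lk(h_1,h_2)$: Let $m,n$ be the genera of $h_1,h_2$. Fix a basis $e_1,\dots,e_m$ of the free abelian group $H_1(h_1)$ and a basis $f_1,\dots,f_n$ of $H_1(h_2)$. Regard the $e_i$ and $f_j$ as represented by closed oriented circles in $h_1$ and $h_2$ respectively, hence in $S^3$, and let $lk(e_i,f_j)\in\mathbb{Z}$ be their linking number in $S^3$; this gives a bilinear map $lk:H_1(h_1)\times H_1(h_2)\to\mathbb{Z}$. Let $M$ be the $m\times n$ integer matrix with $(i,j)$ entry $lk(e_i,f_j)$. Let $d_1\mid d_2\mid\cdots\mid d_l$, with $0\le l\le\min(m,n)$, be the elementary divisors of $M$ over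 $\mathbb{Z}$, i.e. the nonzero diagonal entries (with multiplicity) of the Smith normal form of $M$; they are unique up to sign. If $l>0$, set $Lk(h_1,h_2)=\{|d_1|,|d_2|,\dots,|d_l|\}$, listed with multiplicity; if $l=0$, set $Lk(h_1,h_2)=\{0\}$. *)

theory Defs
  imports
    "HOL-Homology.Homology"
    "HOL-Analysis.Polytope"
    "HOL-Library.Multiset"
    "Jordan_Normal_Form.Matrix"
begin

text \<open>Throughout, the 3-sphere and the circle are the unit spheres \<open>nsphere 3\<close> and \<open>nsphere 1\<close> of
  HOL-Homology: sequences of reals vanishing beyond index 3 (resp. 1), of Euclidean norm 1.\<close>

abbreviation S3 :: "(nat \<Rightarrow> real) topology" where
  "S3 \<equiv> nsphere 3"

abbreviation in_S3 :: "(nat \<Rightarrow> real) set \<Rightarrow> (nat \<Rightarrow> real) topology" where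
  "in_S3 h \<equiv> subtopology S3 h"

section \<open>Handlebody-links\<close>

text \<open>The model of genus \<open>g\<close>: a closed disc with \<open>g\<close> open round holes (of radius 1, centred
  at \<open>3, 6, \<dots>, 3g\<close>), times an interval.\<close>

definition std_handlebody :: "nat \<Rightarrow> (complex \<times> real) set" where
  "std_handlebody g =
     {z. cmod z \<le> 3 * real g + 3 \<and> (\<forall>k\<in>{1..g}. 1 \<le> cmod (z - of_nat (3 * k)))} \<times> {0..1}"

definition handlebody :: "nat \<Rightarrow> (nat \<Rightarrow> real) set \<Rightarrow> bool" where
  "handlebody g h \<longleftrightarrow> h \<subseteq> topspace S3 \<and> in_S3 h homeomorphic_space top_of_set (std_handlebody g)"

text \<open>Compact polyhedra in the sense of PL topology, not necessarily convex.\<close>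

definition compact_polyhedron :: "'a::euclidean_space set \<Rightarrow> bool" where
  "compact_polyhedron X \<longleftrightarrow> (\<exists>F. finite F \<and> (\<forall>P\<in>F. polytope P) \<and> X = \<Union>F)"

text \<open>Tameness: after removing a point of \<open>S\<^sup>3\<close> off both components, some homeomorphism onto
  \<open>\<real>\<^sup>3\<close> carries both components to polyhedra.\<close>

definition tame_pair :: "(nat \<Rightarrow> real) set \<Rightarrow> (nat \<Rightarrow> real) set \<Rightarrow> bool" where
  "tame_pair h1 h2 \<longleftrightarrow>
     (\<exists>p \<phi>. p \<in> topspace S3 - (h1 \<union> h2)
          \<and> homeomorphic_map (in_S3 (topspace S3 - {p})) (euclidean :: (real^3) topology) \<phi>
          \<and> compact_polyhedron (\<phi> ` h1) \<and> compact_polyhedron (\<phi> ` h2))"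

definition handlebody_link2 ::
    "nat \<Rightarrow> nat \<Rightarrow> (nat \<Rightarrow> real) set \<Rightarrow> (nat \<Rightarrow> real) set \<Rightarrow> bool" where
  "handlebody_link2 m n h1 h2 \<longleftrightarrow>
     handlebody m h1 \<and> handlebody n h2 \<and> h1 \<inter> h2 = {} \<and> tame_pair h1 h2"

definition ambient_isotopic :: "(nat \<Rightarrow> real) set \<Rightarrow> (nat \<Rightarrow> real) set \<Rightarrow> bool" where
  "ambient_isotopic L L' \<longleftrightarrow>
     (\<exists>H :: real \<times> (nat \<Rightarrow> real) \<Rightarrow> nat \<Rightarrow> real.
          continuous_map (prod_topology (top_of_set {0..1}) S3) S3 H
        \<and> (\<forall>t\<in>{0..1}. homeomorphic_map S3 S3 (\<lambda>x. H (t, x)))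
        \<and> (\<forall>x\<in>topspace S3. H (0, x) = x)
        \<and> (\<lambda>x. H (1, x)) ` L = L')"

section \<open>Bases of the first homology group, represented by oriented circles\<close>

text \<open>The groups of HOL-Homology are written multiplicatively.\<close>

definition free_abelian_basis :: "('g, 'b) monoid_scheme \<Rightarrow> nat \<Rightarrow> (nat \<Rightarrow> 'g) \<Rightarrow> bool" where
  "free_abelian_basis G m e \<longleftrightarrow>
     (\<forall>i<m. e i \<in> carrier G)
   \<and> bij_betw (\<lambda>c :: nat \<Rightarrow> int. finprod G (\<lambda>i. e i [^]\<^bsub>G\<^esub> c i) {..<m})
       ({..<m} \<rightarrow>\<^sub>E UNIV) (carrier G)"

definition H1_basis :: "(nat \<Rightarrow> real) set \<Rightarrow> nat \<Rightarrow> (nat \<Rightarrow> (nat \<Rightarrow> real) chain set) \<Rightarrow> bool" where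
  "H1_basis h m e \<longleftrightarrow> free_abelian_basis (homology_group 1 (in_S3 h)) m e"

text \<open>An orientation of the circle. Choosing the other generator reverses all representing circles
  at once, in both components, and so does not change any linking number below.\<close>

definition circle_generator :: "(nat \<Rightarrow> real) chain set" where
  "circle_generator =
     (SOME c. c \<in> carrier (homology_group 1 (nsphere 1))
            \<and> generate (homology_group 1 (nsphere 1)) {c} = carrier (homology_group 1 (nsphere 1)))"

definition represents ::
    "(nat \<Rightarrow> real) set \<Rightarrow> ((nat \<Rightarrow> real) \<Rightarrow> nat \<Rightarrow> real) \<Rightarrow> (nat \<Rightarrow> real) chain set \<Rightarrow> bool" where
  "represents h \<alpha> x \<longleftrightarrow>
     continuous_map (nsphere 1) (in_S3 h) \<alpha>
   \<and> hom_induced 1 (nsphere 1) {} (in_S3 h) {} \<alpha> circle_generator = x"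

definition represented_basis ::
    "(nat \<Rightarrow> real) set \<Rightarrow> nat \<Rightarrow> (nat \<Rightarrow> (nat \<Rightarrow> real) chain set)
      \<Rightarrow> (nat \<Rightarrow> (nat \<Rightarrow> real) \<Rightarrow> nat \<Rightarrow> real) \<Rightarrow> bool" where
  "represented_basis h m e \<alpha> \<longleftrightarrow> H1_basis h m e \<and> (\<forall>i<m. represents h (\<alpha> i) (e i))"

section \<open>The linking number\<close>

text \<open>The cone on a closed curve \<open>\<alpha>\<close> in \<open>S\<^sup>3\<close>: the homogeneous extension
  \<open>u \<mapsto> \<bar>u\<bar> \<alpha>(u / \<bar>u\<bar>)\<close> of \<open>\<alpha>\<close> to a map from the plane to 4-space.
  Only the first two entries of \<open>u\<close> are used.\<close>

definition plane_norm :: "(nat \<Rightarrow> real) \<Rightarrow> real" where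
  "plane_norm u = sqrt ((u 0)\<^sup>2 + (u 1)\<^sup>2)"

definition cone_curve :: "((nat \<Rightarrow> real) \<Rightarrow> nat \<Rightarrow> real) \<Rightarrow> (nat \<Rightarrow> real) \<Rightarrow> nat \<Rightarrow> real" where
  "cone_curve \<alpha> u =
     (\<lambda>i. plane_norm u * \<alpha> (\<lambda>k. if k \<le> 1 then u k / plane_norm u else 0) i)"

text \<open>Gauss's definition of the linking number as a mapping degree, in the form suited to
  \<open>S\<^sup>3 \<subseteq> \<real>\<^sup>4\<close>. For \<open>x = (u, v) \<in> \<real>\<^sup>2 \<times> \<real>\<^sup>2\<close> let
  \<open>D(u, v) = \<bar>u\<bar> \<alpha>(u / \<bar>u\<bar>) - \<bar>v\<bar> \<beta>(v / \<bar>v\<bar>)\<close>.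
  If \<open>\<alpha>\<close> and \<open>\<beta>\<close> are disjoint, then \<open>D\<close> has no zero on \<open>S\<^sup>3 = S\<^sup>1 * S\<^sup>1\<close>, and
  \<open>lk(\<alpha>, \<beta>)\<close> is the degree of \<open>D / \<bar>D\<bar>\<close>: it counts with sign the solutions of
  \<open>A(u) = B(v)\<close> for discs \<open>A, B\<close> in general position in the 4-ball with boundaries
  \<open>\<alpha>, \<beta>\<close>, i.e. it is the intersection number of those discs.
  (The sign at such a solution is that of \<open>det (dA, -dB) = det (dA, dB)\<close>.)
  No point at infinity has to be chosen, and \<open>\<alpha>, \<beta>\<close> may be arbitrary continuous closed curves.\<close>

definition gauss_map ::
    "((nat \<Rightarrow> real) \<Rightarrow> nat \<Rightarrow> real) \<Rightarrow> ((nat \<Rightarrow> real) \<Rightarrow> nat \<Rightarrow> real)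
      \<Rightarrow> (nat \<Rightarrow> real) \<Rightarrow> nat \<Rightarrow> real" where
  "gauss_map \<alpha> \<beta> x =
     (let D = (\<lambda>i. cone_curve \<alpha> x i - cone_curve \<beta> (\<lambda>k. x (k + 2)) i)
      in (\<lambda>i. D i / sqrt (\<Sum>j\<le>3. (D j)\<^sup>2)))"

definition linking_number ::
    "((nat \<Rightarrow> real) \<Rightarrow> nat \<Rightarrow> real) \<Rightarrow> ((nat \<Rightarrow> real) \<Rightarrow> nat \<Rightarrow> real) \<Rightarrow> int" where
  "linking_number \<alpha> \<beta> = Brouwer_degree2 3 (gauss_map \<alpha> \<beta>)"

text \<open>Normalisation: the Hopf link formed by the unit circles of the two coordinate planes, each
  with its standard orientation, has linking number 1. (The second curve is parametrised
  with a half-turn, which does not affect its orientation.)\<close>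

lemma linking_number_Hopf:
  "linking_number (\<lambda>s i. if i \<le> 1 then s i else 0)
     (\<lambda>s i. if i = 2 \<or> i = 3 then - s (i - 2) else 0) = 1"
    (is "linking_number ?a ?b = 1")
proof -
  have n: "plane_norm u * (u k / plane_norm u) = u k" if "k \<le> 1" for u k
  proof (cases "plane_norm u = 0")
    case True
    then have "u 0 = 0 \<and> u 1 = 0"
      by (simp add: plane_norm_def sum_power2_eq_zero_iff)
    moreover have "k = 0 \<or> k = 1" using that by linarith
    ultimately show ?thesis by auto
  qed simp
  have "gauss_map ?a ?b x = x" if "x \<in> topspace (nsphere 3)" for x
  proof -
    from that have x: "(\<Sum>j\<le>3. (x j)\<^sup>2) = 1" "\<And>i. i > 3 \<Longrightarrow> x i = 0"
      by (auto simp: nsphere)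
    have 1: "cone_curve ?a x i = (if i \<le> 1 then x i else 0)" for i
      using n[of i x] by (auto simp: cone_curve_def)
    have 2: "cone_curve ?b (\<lambda>k. x (k + 2)) i = (if i = 2 \<or> i = 3 then - x i else 0)" for i
      using n[of "i - 2" "\<lambda>k. x (k + 2)"] by (auto simp: cone_curve_def eval_nat_numeral)
    have "(\<lambda>i. cone_curve ?a x i - cone_curve ?b (\<lambda>k. x (k + 2)) i) = x"
    proof
      fix i :: nat
      consider "i \<le> 1" | "i = 2 \<or> i = 3" | "i > 3" by linarith
      then show "cone_curve ?a x i - cone_curve ?b (\<lambda>k. x (k + 2)) i = x i"
        unfolding 1 2 by cases (use x in auto)
    qed
    then show ?thesis by (simp add: gauss_map_def x)
  qed
  then have "Brouwer_degree2 3 (gauss_map ?a ?b) = Brouwer_degree2 3 id"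
    by (intro Brouwer_degree2_eq) simp
  then show ?thesis by (simp add: linking_number_def)
qed

section \<open>Elementary divisors and the invariant\<close>

definition smith_form_of :: "int mat \<Rightarrow> int mat \<Rightarrow> bool" where
  "smith_form_of M D \<longleftrightarrow>
     (\<exists>P Q. P \<in> carrier_mat (dim_row M) (dim_row M) \<and> invertible_mat P
          \<and> Q \<in> carrier_mat (dim_col M) (dim_col M) \<and> invertible_mat Q
          \<and> D = P * M * Q)
   \<and> diagonal_mat D
   \<and> (\<forall>i. Suc i < min (dim_row M) (dim_col M) \<longrightarrow> D $$ (i, i) dvd D $$ (Suc i, Suc i))"

definition abs_nonzero_diag :: "int mat \<Rightarrow> int multiset" where
  "abs_nonzero_diag D =
     {# \<bar>D $$ (i, i)\<bar>. i \<in># mset_set {i. i < min (dim_row D) (dim_col D) \<and> D $$ (i, i) \<noteq> 0} #}"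

definition elementary_divisors :: "int mat \<Rightarrow> int multiset" where
  "elementary_divisors M = (THE E. \<exists>D. smith_form_of M D \<and> E = abs_nonzero_diag D)"

definition linking_matrix ::
    "nat \<Rightarrow> nat \<Rightarrow> (nat \<Rightarrow> (nat \<Rightarrow> real) \<Rightarrow> nat \<Rightarrow> real) \<Rightarrow> (nat \<Rightarrow> (nat \<Rightarrow> real) \<Rightarrow> nat \<Rightarrow> real)
      \<Rightarrow> int mat" where
  "linking_matrix m n \<alpha> \<beta> = mat m n (\<lambda>(i, j). linking_number (\<alpha> i) (\<beta> j))"

text \<open>The value of the invariant computed from particular bases, represented by the circles
  \<open>\<alpha>\<close> and \<open>\<beta>\<close>.\<close>

definition Lk_wrt ::
    "nat \<Rightarrow> nat \<Rightarrow> (nat \<Rightarrow> (nat \<Rightarrow> real) \<Rightarrow> nat \<Rightarrow> real) \<Rightarrow> (nat \<Rightarrow> (nat \<Rightarrow> real) \<Rightarrow> nat \<Rightarrow> real)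
      \<Rightarrow> int multiset" where
  "Lk_wrt m n \<alpha> \<beta> =
     (let E = elementary_divisors (linking_matrix m n \<alpha> \<beta>) in if E = {#} then {#0#} else E)"

definition Lk :: "(nat \<Rightarrow> real) set \<Rightarrow> (nat \<Rightarrow> real) set \<Rightarrow> int multiset" where
  "Lk h1 h2 =
     (THE E. \<exists>m n e f \<alpha> \<beta>. handlebody m h1 \<and> handlebody n h2
        \<and> represented_basis h1 m e \<alpha> \<and> represented_basis h2 n f \<beta> \<and> E = Lk_wrt m n \<alpha> \<beta>)"

end

theory Submission
  imports Defs
begin

text \<open>The map \<open>gauss_map \<alpha> \<beta>\<close> factors as \<open>G\<^sub>\<beta> \<circ> \<Sigma>\<^sup>2\<alpha>\<close>, where \<open>\<Sigma>\<^sup>2\<alpha>\<close> is the double suspension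
  \<open>S\<^sup>3 = \<Sigma>\<^sup>2S\<^sup>1 \<rightarrow> \<Sigma>\<^sup>2h\<close> of \<open>\<alpha>: S\<^sup>1 \<rightarrow> h\<close> and \<open>G\<^sub>\<beta>: \<Sigma>\<^sup>2h \<rightarrow> S\<^sup>3\<close> depends on \<open>\<beta>\<close> only.
  Since suspension is a natural isomorphism in homology, \<open>lk(\<alpha>, \<beta>)\<close> is, up to a fixed nonzero
  factor, the value of a homomorphism \<open>H\<^sub>1(h) \<rightarrow> \<int>\<close> at the class of \<open>\<alpha>\<close>. Exchanging the
  two curves changes the degree by a constant sign, so \<open>lk\<close> is bilinear on homology and a change of bases
  replaces the linking matrix \<open>M\<close> by \<open>P M Q\<close> with \<open>P, Q\<close> invertible; this does not
  change the set of Smith forms of \<open>M\<close>, nor does transposition or a sign change affect their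
  absolute diagonals. An ambient isotopy induces a homotopy of Gauss maps, hence
  preserves linking numbers, and it matches the components of the two links because handlebodies are
  connected and compact.\<close>

section \<open>Suspension in coordinates\<close>

text \<open>A change of basis writes the class of a new circle as a combination of the old classes,
  but gives no direct relation between the circles themselves: Gauss maps of single curves cannot be
  compared by a homotopy, and the linking number has to be read off the homology class alone. The
  obstacle is the degree: the class lives in dimension 1, the Gauss map acts in dimension 3, and the
  two suspensions bridge the gap. \<open>gauss_map\<close> is suited to this, since the last two of
  its four source coordinates enter only through \<open>\<beta>\<close> and can serve as suspension
  coordinates for \<open>\<alpha>\<close>. The nonzero factor is the integer attached to the class
  in H_3(S^3) that the suspensions carry to \<open>circle_generator\<close>; it depends on neither
  the curves nor the handlebody, so it cancels from linear relations. Suspensions are realised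
  inside unit spheres, with one further coordinate as height, so that all spaces live in one type
  and naturality concerns explicit formulas. Since division by zero yields 0, these formulas are
  total at poles and cone points.\<close>

definition nrm :: "nat \<Rightarrow> (nat \<Rightarrow> real) \<Rightarrow> real" where
  "nrm k x = sqrt (\<Sum>i<k. (x i)\<^sup>2)"

definition dirn :: "nat \<Rightarrow> (nat \<Rightarrow> real) \<Rightarrow> nat \<Rightarrow> real" where
  "dirn k x = (\<lambda>i. if i < k then x i / nrm k x else 0)"

definition usphere :: "nat \<Rightarrow> (nat \<Rightarrow> real) set" where
  "usphere k = {x. nrm k x = 1 \<and> (\<forall>i\<ge>k. x i = 0)}"

text \<open>The unreduced suspension as a union of meridians: a point other than a pole lies on the
  meridian over \<open>dirn k z\<close>, and the two poles satisfy the condition vacuously.\<close>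

definition susp :: "nat \<Rightarrow> (nat \<Rightarrow> real) set \<Rightarrow> (nat \<Rightarrow> real) set" where
  "susp k X = {z \<in> usphere (Suc k). nrm k z \<noteq> 0 \<longrightarrow> dirn k z \<in> X}"

text \<open>The cone on \<open>f\<close>, homogeneous of degree 1. At the cone point
  \<open>f\<close> is evaluated at the zero sequence, but the arbitrary value is multiplied by
  0.\<close>

definition radial_ext :: "nat \<Rightarrow> ((nat \<Rightarrow> real) \<Rightarrow> nat \<Rightarrow> real) \<Rightarrow> (nat \<Rightarrow> real) \<Rightarrow> nat \<Rightarrow> real" where
  "radial_ext k f z = (\<lambda>i. nrm k z * f (dirn k z) i)"

text \<open>Source and target may sit in different dimensions: the height is coordinate
  \<open>k\<close> before and coordinate \<open>l\<close> after the map.\<close>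

definition susp_map ::
    "nat \<Rightarrow> nat \<Rightarrow> ((nat \<Rightarrow> real) \<Rightarrow> nat \<Rightarrow> real) \<Rightarrow> (nat \<Rightarrow> real) \<Rightarrow> nat \<Rightarrow> real" where
  "susp_map k l f z = (radial_ext k f z)(l := z k)"

section \<open>Norms and directions of leading coordinates\<close>

lemma nrm_nonneg [simp]: "0 \<le> nrm k x"
  by (simp add: nrm_def sum_nonneg)

lemma nrm_sq: "(nrm k x)\<^sup>2 = (\<Sum>i<k. (x i)\<^sup>2)"
  by (simp add: nrm_def sum_nonneg)

lemma nrm_Suc_sq: "(nrm (Suc k) x)\<^sup>2 = (nrm k x)\<^sup>2 + (x k)\<^sup>2"
  by (simp add: nrm_sq)

lemma nrm_cong: "(\<And>i. i < k \<Longrightarrow> x i = y i) \<Longrightarrow> nrm k x = nrm k y"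
  by (simp add: nrm_def)

lemma nrm_scale: "nrm k (\<lambda>i. c * x i) = \<bar>c\<bar> * nrm k x"
  by (simp add: nrm_def power_mult_distrib real_sqrt_mult flip: sum_distrib_left)

lemma nrm_eq_0_iff: "nrm k x = 0 \<longleftrightarrow> (\<forall>i<k. x i = 0)"
  by (auto simp: nrm_def sum_nonneg_eq_0_iff)

lemma abs_le_nrm: "i < k \<Longrightarrow> \<bar>x i\<bar> \<le> nrm k x"
  unfolding nrm_def by (intro real_le_rsqrt) (auto intro!: member_le_sum simp flip: power2_eq_square)

lemma nrm_mono: "k \<le> l \<Longrightarrow> nrm k x \<le> nrm l x"
  unfolding nrm_def by (intro real_sqrt_le_mono sum_mono2) auto

lemma nrm_dirn: "nrm k x \<noteq> 0 \<Longrightarrow> j \<le> k \<Longrightarrow> nrm j (dirn k x) = nrm j x / nrm k x"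
  using nrm_scale[of j "1 / nrm k x" x] nrm_cong[of j "dirn k x" "\<lambda>i. 1 / nrm k x * x i"]
  by (simp add: dirn_def)

lemma dirn_in_usphere: "nrm k x \<noteq> 0 \<Longrightarrow> dirn k x \<in> usphere k"
  by (simp add: usphere_def nrm_dirn) (simp add: dirn_def)

lemma dirn_cong: "(\<And>i. i < k \<Longrightarrow> x i = y i) \<Longrightarrow> dirn k x = dirn k y"
  by (auto simp: dirn_def cong: nrm_cong)

lemma dirn_scale: "c > 0 \<Longrightarrow> dirn k (\<lambda>i. c * x i) = dirn k x"
  by (auto simp: dirn_def nrm_scale)

lemma dirn_dirn: "nrm k x \<noteq> 0 \<Longrightarrow> j \<le> k \<Longrightarrow> dirn j (dirn k x) = dirn j x"
  using dirn_scale[of "1 / nrm k x" j x] dirn_cong[of j "dirn k x" "\<lambda>i. 1 / nrm k x * x i"]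
  by (simp add: dirn_def order.strict_iff_order)

lemma dirn_id: "x \<in> usphere k \<Longrightarrow> dirn k x = x"
  by (auto simp: dirn_def usphere_def)

lemma usphere_bound: "x \<in> usphere k \<Longrightarrow> \<bar>x i\<bar> \<le> 1"
  using abs_le_nrm[of i k x] by (cases "i < k") (auto simp: usphere_def)

lemma nrm_mult_dirn: "i < k \<Longrightarrow> nrm k x * dirn k x i = x i"
  by (auto simp: dirn_def nrm_eq_0_iff)

lemma nsphere_eq_usphere: "nsphere n = top_of_set (usphere (Suc n))"
proof -
  have "{x. (\<Sum>i\<le>n. (x i)\<^sup>2) = 1 \<and> (\<forall>i>n. x i = 0)} = usphere (Suc n)"
    by (auto simp: usphere_def nrm_def lessThan_Suc_atMost Suc_le_eq)
  then show ?thesis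
    by (simp add: nsphere euclidean_product_topology)
qed

lemma susp_usphere: "susp k (usphere k) = usphere (Suc k)"
  by (auto simp: susp_def dirn_in_usphere)

section \<open>Continuity of the coordinate constructions\<close>

lemma continuous_on_coordinatewise_iff:
  fixes f :: "'a::topological_space \<Rightarrow> nat \<Rightarrow> real"
  shows "continuous_on S f \<longleftrightarrow> (\<forall>i. continuous_on S (\<lambda>x. f x i))"
  by (metis continuous_on_coordinatewise_then_product continuous_on_product_then_coordinatewise)

lemma continuous_on_coord:
  fixes f :: "'a::topological_space \<Rightarrow> nat \<Rightarrow> real"
  shows "continuous_on S f \<Longrightarrow> continuous_on S (\<lambda>x. f x i)"
  by (rule continuous_on_product_then_coordinatewise)

lemma continuous_on_nrm [continuous_intros]:
  assumes "continuous_on S f"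
  shows "continuous_on S (\<lambda>x. nrm k (f x))"
  unfolding nrm_def by (intro continuous_intros continuous_on_coord[OF assms])

lemma continuous_on_dirn [continuous_intros]:
  assumes "continuous_on S f" "\<And>x. x \<in> S \<Longrightarrow> nrm k (f x) \<noteq> 0"
  shows "continuous_on S (\<lambda>x. dirn k (f x))"
  unfolding continuous_on_coordinatewise_iff dirn_def
proof
  fix i show "continuous_on S (\<lambda>x. if i < k then f x i / nrm k (f x) else 0)"
    by (cases "i < k") (auto intro!: continuous_intros continuous_on_coord[OF assms(1)] assms)
qed

lemma continuous_on_fun_upd [continuous_intros]:
  fixes f :: "'a::topological_space \<Rightarrow> nat \<Rightarrow> real"
  assumes "continuous_on S f" "continuous_on S g"
  shows "continuous_on S (\<lambda>x. (f x)(l := g x))"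
  unfolding continuous_on_coordinatewise_iff
proof
  fix i show "continuous_on S (\<lambda>x. ((f x)(l := g x)) i)"
    by (cases "i = l") (auto intro!: continuous_on_coord[OF assms(1)] assms)
qed

text \<open>At a zero of \<open>g\<close> the factor \<open>h\<close> may have no limit, but it is
  bounded, so the product is squeezed to 0. At other points \<open>g\<close> is nonzero on a
  relatively open neighbourhood, where the ordinary product rule applies. This is continuity at the
  cone point.\<close>

lemma continuous_on_vanishing_mult:
  fixes g h :: "'a::topological_space \<Rightarrow> real"
  assumes g: "continuous_on S g" and h: "continuous_on {x\<in>S. g x \<noteq> 0} h"
    and b: "\<And>x. x \<in> S \<Longrightarrow> g x \<noteq> 0 \<Longrightarrow> \<bar>h x\<bar> \<le> B"
  shows "continuous_on S (\<lambda>x. g x * h x)"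
  unfolding continuous_on_def
proof
  fix x assume x: "x \<in> S"
  have gx: "(g \<longlongrightarrow> g x) (at x within S)"
    using g x by (simp add: continuous_on_def)
  show "((\<lambda>x. g x * h x) \<longlongrightarrow> g x * h x) (at x within S)"
  proof (cases "g x = 0")
    case True
    have "norm (g y * h y) \<le> \<bar>g y\<bar> * B" if "y \<in> S" for y
      using b[OF that] by (cases "g y = 0") (simp_all add: abs_mult mult_left_mono)
    then have "\<forall>\<^sub>F y in at x within S. norm (g y * h y) \<le> \<bar>g y\<bar> * B"
      by (simp add: eventually_at_filter)
    moreover have "((\<lambda>y. \<bar>g y\<bar> * B) \<longlongrightarrow> 0) (at x within S)"
      using tendsto_mult[OF tendsto_rabs[OF gx] tendsto_const[of B]] True by simp
    ultimately show ?thesis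
      using True by (auto intro: Lim_null_comparison)
  next
    case False
    have "openin (top_of_set S) (S \<inter> g -` (- {0}))"
      by (rule continuous_openin_preimage_gen[OF g]) auto
    then obtain T where T: "open T" "S \<inter> g -` (- {0}) = S \<inter> T"
      by (auto simp: openin_open)
    have S': "{x\<in>S. g x \<noteq> 0} = S \<inter> T" using T by auto
    have "(h \<longlongrightarrow> h x) (at x within {x\<in>S. g x \<noteq> 0})"
      using h x False by (simp add: continuous_on_def)
    moreover have "at x within (S \<inter> T) = at x within S"
      using x False S' T(1) by (intro at_within_nhd[of x T]) auto
    ultimately show ?thesis
      using S' by (auto intro!: tendsto_intros gx)
  qed
qed

text \<open>The map \<open>F x\<close> under the cone may vary with the parameter \<open>x\<close>,
  which is what a homotopy of curves requires. Values on a unit sphere have coordinates bounded by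
  1, which supplies the bound at the cone point.\<close>

lemma continuous_on_radial_ext:
  assumes u: "continuous_on S u"
    and f: "continuous_on {x\<in>S. nrm k (u x) \<noteq> 0} (\<lambda>x. F x (dirn k (u x)))"
    and b: "\<And>x. x \<in> S \<Longrightarrow> nrm k (u x) \<noteq> 0 \<Longrightarrow> F x (dirn k (u x)) \<in> usphere l"
  shows "continuous_on S (\<lambda>x. radial_ext k (F x) (u x))"
  unfolding continuous_on_coordinatewise_iff radial_ext_def
proof
  fix i show "continuous_on S (\<lambda>x. nrm k (u x) * F x (dirn k (u x)) i)"
    using f b by (intro continuous_on_vanishing_mult[where B = 1] continuous_intros u)
      (auto simp: continuous_on_coordinatewise_iff intro: usphere_bound)
qed

lemma nrm_radial_ext: "f (dirn k z) \<in> usphere l \<or> nrm k z = 0 \<Longrightarrow> nrm l (radial_ext k f z) = nrm k z"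
  by (auto simp: radial_ext_def nrm_scale usphere_def)

lemma dirn_radial_ext:
  "f (dirn k z) \<in> usphere l \<Longrightarrow> nrm k z \<noteq> 0 \<Longrightarrow> dirn l (radial_ext k f z) = f (dirn k z)"
  unfolding radial_ext_def using order.not_eq_order_implies_strict[of 0 "nrm k z"]
  by (subst dirn_scale) (auto simp: dirn_id)

lemma nrm_susp_map: "nrm l (susp_map k l f z) = nrm l (radial_ext k f z)"
  and dirn_susp_map: "dirn l (susp_map k l f z) = dirn l (radial_ext k f z)"
  by (auto simp: susp_map_def intro: nrm_cong dirn_cong)

lemma susp_height [simp]: "susp_map k l f z l = z k"
  by (simp add: susp_map_def)

lemma usphere_Suc_iff:
  "z \<in> usphere (Suc k) \<longleftrightarrow> (nrm k z)\<^sup>2 + (z k)\<^sup>2 = 1 \<and> (\<forall>i>k. z i = 0)"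
proof -
  have "nrm (Suc k) z = 1 \<longleftrightarrow> (nrm (Suc k) z)\<^sup>2 = 1"
    by (auto simp: power2_eq_1_iff) (metis nrm_nonneg neg_0_le_iff_le not_one_le_zero)
  then show ?thesis
    by (auto simp: usphere_def nrm_Suc_sq Suc_le_eq)
qed

lemma susp_map_in_susp:
  assumes "f \<in> X \<rightarrow> Y" "Y \<subseteq> usphere l" "z \<in> susp k X"
  shows "susp_map k l f z \<in> susp l Y"
proof -
  have z: "z \<in> usphere (Suc k)" "nrm k z \<noteq> 0 \<Longrightarrow> f (dirn k z) \<in> Y"
    using assms by (auto simp: susp_def)
  have n: "nrm l (susp_map k l f z) = nrm k z"
    using z assms(2) by (auto simp: nrm_susp_map intro: nrm_radial_ext)
  moreover have "\<forall>i>l. susp_map k l f z i = 0"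
    using z(2) assms(2) by (cases "nrm k z = 0") (auto simp: susp_map_def radial_ext_def usphere_def)
  moreover have "dirn l (susp_map k l f z) \<in> Y" if "nrm k z \<noteq> 0"
    using z(2)[OF that] assms(2) that by (subst dirn_susp_map, subst dirn_radial_ext) auto
  ultimately show ?thesis
    using z(1) by (auto simp: susp_def usphere_Suc_iff)
qed

lemma continuous_on_susp_map:
  assumes "continuous_on X f" "f \<in> X \<rightarrow> usphere l"
  shows "continuous_on (susp k X) (susp_map k l f)"
  unfolding susp_map_def
proof (intro continuous_on_fun_upd continuous_on_coord[OF continuous_on_id])
  show "continuous_on (susp k X) (radial_ext k f)"
  proof (rule continuous_on_radial_ext[where F = "\<lambda>_. f" and l = l])
    show "continuous_on {x \<in> susp k X. nrm k x \<noteq> 0} (\<lambda>x. f (dirn k x))"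
      by (rule continuous_on_compose2[OF assms(1) continuous_on_dirn[OF continuous_on_id]]) (auto simp: susp_def)
  qed (use assms(2) in \<open>auto simp: susp_def\<close>)
qed

lemma continuous_map_susp_map:
  assumes "continuous_map (top_of_set X) (top_of_set Y) f" "Y \<subseteq> usphere l"
  shows "continuous_map (top_of_set (susp k X)) (top_of_set (susp l Y)) (susp_map k l f)"
proof -
  have f: "continuous_on X f" "f \<in> X \<rightarrow> Y" using assms(1) by auto
  then have "continuous_on (susp k X) (susp_map k l f)"
    using assms(2) by (intro continuous_on_susp_map) auto
  then show ?thesis
    using susp_map_in_susp[OF f(2) assms(2)] by auto
qed

lemma homotopic_with_canonI:
  assumes "continuous_on ({0..1::real} \<times> S) h"
    and "\<And>t x. 0 \<le> t \<Longrightarrow> t \<le> 1 \<Longrightarrow> x \<in> S \<Longrightarrow> h (t, x) \<in> T"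
    and "\<And>x. x \<in> S \<Longrightarrow> h (0, x) = f x" "\<And>x. x \<in> S \<Longrightarrow> h (1, x) = g x"
  shows "homotopic_with_canon (\<lambda>_. True) S T f g"
proof -
  have "continuous_map (prod_topology (top_of_set {0..1::real}) (top_of_set S)) (top_of_set T) h"
    using assms(1,2) by (auto simp: prod_topology_subtopology_eu)
  then show ?thesis
    using assms(3,4) by (auto simp: homotopic_with)
qed

text \<open>If the straight segments to \<open>p\<close> avoid the origin, their radial projections
  to the sphere contract \<open>B\<close> to \<open>p\<close>.\<close>

lemma contractible_starlike:
  assumes B: "B \<subseteq> usphere k" and p: "p \<in> B"
    and star: "\<And>z t. z \<in> B \<Longrightarrow> 0 \<le> t \<Longrightarrow> t \<le> 1 \<Longrightarrow>
      nrm k (\<lambda>i. (1 - t) * z i + t * p i) \<noteq> 0 \<and> dirn k (\<lambda>i. (1 - t) * z i + t * p i) \<in> B"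
  shows "contractible_space (top_of_set B)"
proof -
  let ?h = "\<lambda>q. dirn k (\<lambda>i. (1 - fst q) * snd q i + fst q * p i)"
  have "continuous_on ({0..1} \<times> B) (\<lambda>q. \<lambda>i. (1 - fst q) * snd q i + fst q * p i)"
    unfolding continuous_on_coordinatewise_iff by (intro allI continuous_intros continuous_on_coord[OF continuous_on_snd[OF continuous_on_id]])
  then have "continuous_on ({0..1} \<times> B) ?h"
    using star by (intro continuous_on_dirn) auto
  then have "homotopic_with_canon (\<lambda>_. True) B B id (\<lambda>x. p)"
    using star B p by (intro homotopic_with_canonI[where h = ?h]) (auto simp: dirn_id subset_iff)
  then show ?thesis
    unfolding contractible_space_def by blast
qed

section \<open>Naturality of the suspension isomorphism\<close>

definition pole :: "nat \<Rightarrow> real \<Rightarrow> nat \<Rightarrow> real" where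
  "pole k \<sigma> = (\<lambda>i. 0)(k := \<sigma>)"

text \<open>The point of height \<open>\<tau>\<close> on the meridian over \<open>x\<close>;
  together with \<open>dirn k\<close> it gives product coordinates away from the poles.\<close>

definition susp_lift :: "nat \<Rightarrow> real \<Rightarrow> (nat \<Rightarrow> real) \<Rightarrow> nat \<Rightarrow> real" where
  "susp_lift k \<tau> x = (\<lambda>i. sqrt (1 - \<tau>\<^sup>2) * x i)(k := \<tau>)"

lemma pole_height [simp]: "pole k \<sigma> k = \<sigma>"
  by (simp add: pole_def)

lemma susp_subset_usphere: "susp k X \<subseteq> usphere (Suc k)"
  by (auto simp: susp_def)

lemma pole_in_susp: "\<sigma>\<^sup>2 = 1 \<Longrightarrow> pole k \<sigma> \<in> susp k X"
  by (auto simp: susp_def usphere_Suc_iff pole_def nrm_def)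

section \<open>Contraction of the two parts of a suspension to their poles\<close>

lemma nrm_join_pole:
  assumes "0 \<le> t" "t \<le> 1"
  shows "nrm k (\<lambda>i. (1 - t) * z i + t * pole k \<sigma> i) = (1 - t) * nrm k z"
proof -
  have "nrm k (\<lambda>i. (1 - t) * z i + t * pole k \<sigma> i) = nrm k (\<lambda>i. (1 - t) * z i)"
    by (intro nrm_cong) (simp add: pole_def)
  then show ?thesis using assms by (simp add: nrm_scale)
qed

text \<open>Moving towards a pole scales the first \<open>k\<close> coordinates by
  \<open>1 - t\<close> and changes only the height otherwise, so the projected point stays on the
  meridian of \<open>z\<close>, or has reached a pole.\<close>

lemma join_pole_in_susp:
  assumes z: "z \<in> susp k X" and t: "0 \<le> t" "t \<le> 1"
    and nz: "nrm (Suc k) (\<lambda>i. (1 - t) * z i + t * pole k \<sigma> i) \<noteq> 0" (is "nrm _ ?w \<noteq> 0")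
  shows "dirn (Suc k) ?w \<in> susp k X"
proof -
  have "dirn k (dirn (Suc k) ?w) \<in> X" if "nrm k (dirn (Suc k) ?w) \<noteq> 0"
  proof -
    have "nrm k ?w \<noteq> 0" using that nz by (auto simp: nrm_dirn)
    then have *: "t < 1" "nrm k z \<noteq> 0"
      using t by (auto simp: nrm_join_pole order.strict_iff_order)
    have "dirn k (dirn (Suc k) ?w) = dirn k ?w" using nz by (simp add: dirn_dirn)
    also have "\<dots> = dirn k (\<lambda>i. (1 - t) * z i)"
      by (intro dirn_cong) (simp add: pole_def)
    also have "\<dots> = dirn k z" using * by (simp add: dirn_scale)
    finally show ?thesis using z * by (simp add: susp_def)
  qed
  then show ?thesis using nz by (auto simp: susp_def dirn_in_usphere)
qed

lemma contractible_susp_upper: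
  "contractible_space (top_of_set {z \<in> susp k X. -1 < z k})"
proof (rule contractible_starlike[where k = "Suc k" and p = "pole k 1"])
  fix z :: "nat \<Rightarrow> real" and t :: real assume z: "z \<in> {z \<in> susp k X. -1 < z k}" and t: "0 \<le> t" "t \<le> 1"
  let ?w = "\<lambda>i. (1 - t) * z i + t * pole k 1 i"
  \<comment> \<open>The part also contains points below the equator, so heights along the segment
    can be negative. What matters is that the segment meets the axis only at height 1, which
    excludes both the origin and the south pole.\<close>
  have wk: "?w k = 1" if "nrm k ?w = 0"
  proof (cases "t = 1")
    case False
    then have "nrm k z = 0" using that t by (simp add: nrm_join_pole)
    then have "(z k)\<^sup>2 = 1" using z by (simp add: susp_def usphere_Suc_iff)
    then have "z k = 1" using z by (auto simp: power2_eq_1_iff)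
    then show ?thesis by (simp add: pole_def)
  qed (simp add: pole_def)
  have nz: "nrm (Suc k) ?w \<noteq> 0"
  proof
    assume "nrm (Suc k) ?w = 0"
    then have *: "\<forall>i<Suc k. ?w i = 0" by (simp only: nrm_eq_0_iff)
    then have "nrm k ?w = 0" by (simp add: nrm_eq_0_iff)
    from wk[OF this] show False using *[rule_format, of k] by simp
  qed
  have u: "dirn (Suc k) ?w \<in> usphere (Suc k)" using nz by (rule dirn_in_usphere)
  have "dirn (Suc k) ?w k \<noteq> -1"
  proof
    assume eq: "dirn (Suc k) ?w k = -1"
    then have "nrm k (dirn (Suc k) ?w) = 0" using u by (simp add: usphere_Suc_iff)
    then have "nrm k ?w = 0" using nz by (simp add: nrm_dirn)
    then have "dirn (Suc k) ?w k \<ge> 0" using wk by (simp add: dirn_def)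
    with eq show False by simp
  qed
  then have "-1 < dirn (Suc k) ?w k" using usphere_bound[OF u, of k] by linarith
  then show "nrm (Suc k) ?w \<noteq> 0 \<and> dirn (Suc k) ?w \<in> {z \<in> susp k X. -1 < z k}"
    using nz z t by (auto intro: join_pole_in_susp)
qed (use susp_subset_usphere in \<open>auto simp: pole_in_susp\<close>)

lemma contractible_susp_lower:
  "contractible_space (top_of_set {z \<in> susp k X. z k < 0})"
proof (rule contractible_starlike[where k = "Suc k" and p = "pole k (-1)"])
  fix z :: "nat \<Rightarrow> real" and t :: real assume z: "z \<in> {z \<in> susp k X. z k < 0}" and t: "0 \<le> t" "t \<le> 1"
  let ?w = "\<lambda>i. (1 - t) * z i + t * pole k (-1) i"
  have wk: "?w k < 0"
  proof (cases "t = 1")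
    case False
    then have "(1 - t) * z k < 0" using t z by (intro mult_pos_neg) auto
    then show ?thesis using t by (simp add: pole_def)
  qed (simp add: pole_def)
  have nz: "nrm (Suc k) ?w \<noteq> 0"
    using wk unfolding nrm_eq_0_iff by force
  have "nrm (Suc k) ?w > 0" using nz by (simp add: order.strict_iff_order)
  then have "dirn (Suc k) ?w k < 0"
    using wk by (simp add: dirn_def divide_neg_pos)
  then show "nrm (Suc k) ?w \<noteq> 0 \<and> dirn (Suc k) ?w \<in> {z \<in> susp k X. z k < 0}"
    using nz z t by (auto intro: join_pole_in_susp)
qed (use susp_subset_usphere in \<open>auto simp: pole_in_susp\<close>)

section \<open>The band between south pole and equator as a product\<close>

lemma nrm_susp_lift: "x \<in> usphere k \<Longrightarrow> \<bar>\<tau>\<bar> \<le> 1 \<Longrightarrow> nrm k (susp_lift k \<tau> x) = sqrt (1 - \<tau>\<^sup>2)"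
proof -
  assume x: "x \<in> usphere k" and "\<bar>\<tau>\<bar> \<le> 1"
  then have "\<tau>\<^sup>2 \<le> 1" by (simp add: abs_square_le_1)
  moreover have "nrm k (susp_lift k \<tau> x) = nrm k (\<lambda>i. sqrt (1 - \<tau>\<^sup>2) * x i)"
    by (rule nrm_cong) (simp add: susp_lift_def)
  ultimately show ?thesis using x by (simp add: nrm_scale usphere_def)
qed

lemma dirn_susp_lift: "x \<in> usphere k \<Longrightarrow> \<bar>\<tau>\<bar> < 1 \<Longrightarrow> dirn k (susp_lift k \<tau> x) = x"
proof -
  assume x: "x \<in> usphere k" and "\<bar>\<tau>\<bar> < 1"
  then have "\<tau>\<^sup>2 < 1" by (simp add: abs_square_less_1)
  moreover have "dirn k (susp_lift k \<tau> x) = dirn k (\<lambda>i. sqrt (1 - \<tau>\<^sup>2) * x i)"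
    by (rule dirn_cong) (simp add: susp_lift_def)
  ultimately show ?thesis using x by (simp add: dirn_scale dirn_id)
qed

lemma susp_lift_in_susp: "X \<subseteq> usphere k \<Longrightarrow> x \<in> X \<Longrightarrow> \<bar>\<tau>\<bar> < 1 \<Longrightarrow> susp_lift k \<tau> x \<in> susp k X"
proof -
  assume X: "X \<subseteq> usphere k" "x \<in> X" and t: "\<bar>\<tau>\<bar> < 1"
  then have "\<tau>\<^sup>2 < 1" by (simp add: abs_square_less_1)
  with X t show ?thesis
    by (auto simp: susp_def usphere_Suc_iff nrm_susp_lift dirn_susp_lift subset_iff) (auto simp: susp_lift_def usphere_def)
qed

lemma susp_lift_height [simp]: "susp_lift k \<tau> x k = \<tau>"
  by (simp add: susp_lift_def)

lemma susp_lift_dirn: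
  assumes "z \<in> usphere (Suc k)"
  shows "susp_lift k (z k) (dirn k z) = z"
proof -
  have z: "1 - (z k)\<^sup>2 = (nrm k z)\<^sup>2" "\<forall>i>k. z i = 0" using assms by (auto simp: usphere_Suc_iff)
  show ?thesis
  proof
    fix i show "susp_lift k (z k) (dirn k z) i = z i"
      using z nrm_mult_dirn[of i k z] by (cases "i < k"; cases "i = k") (auto simp: susp_lift_def dirn_def)
  qed
qed

lemma susp_nrm_nonzero: "z \<in> susp k X \<Longrightarrow> -1 < z k \<Longrightarrow> z k < 0 \<Longrightarrow> nrm k z \<noteq> 0"
  using abs_square_less_1[of "z k"] by (auto simp: susp_def usphere_Suc_iff)

text \<open>The band is \<open>X\<close> times an open interval of heights: \<open>dirn k\<close>
  forgets the height, and \<open>susp_lift k (-1/2)\<close>, at a height inside the interval, is a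
  section and homotopy inverse.\<close>

lemma iso_dirn:
  assumes X: "X \<subseteq> usphere k"
  shows "hom_induced p (top_of_set {z \<in> susp k X. -1 < z k \<and> z k < 0}) {} (top_of_set X) {} (dirn k)
     \<in> iso (homology_group p (top_of_set {z \<in> susp k X. -1 < z k \<and> z k < 0}))
           (homology_group p (top_of_set X))" (is "_ \<in> iso (homology_group p (top_of_set ?B)) _")
proof (rule homotopy_equivalence_homology_group_isomorphism)
  have d: "dirn k z \<in> X" "nrm k z \<noteq> 0" if "z \<in> ?B" for z
    using susp_nrm_nonzero[of z k X] that by (auto simp: susp_def)
  have l: "susp_lift k \<tau> x \<in> ?B" "dirn k (susp_lift k \<tau> x) = x" if "x \<in> X" "-1 < \<tau>" "\<tau> < 0" for x \<tau>
    using that X susp_lift_in_susp[OF X, of x \<tau>] dirn_susp_lift[of x k \<tau>] by (auto simp: abs_less_iff)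
  show "continuous_map (top_of_set ?B) (top_of_set X) (dirn k)"
    using d by (auto intro!: continuous_on_dirn[OF continuous_on_id])
  have "continuous_on X (susp_lift k (-1/2))"
    unfolding susp_lift_def continuous_on_coordinatewise_iff
  proof
    fix i show "continuous_on X (\<lambda>x. ((\<lambda>i. sqrt (1 - (-1/2)\<^sup>2) * x i)(k := -1/2)) i)"
      by (cases "i = k") (auto intro!: continuous_intros continuous_on_coord[OF continuous_on_id])
  qed
  then show "continuous_map (top_of_set X) (top_of_set ?B) (susp_lift k (-1/2))"
    using l by auto
  show "homotopic_with_canon (\<lambda>_. True) X X (dirn k \<circ> susp_lift k (-1/2)) id"
    by (rule homotopic_with_canonI[where h = snd, OF continuous_on_snd[OF continuous_on_id]])
      (auto simp: l)
  define c :: real where "c = -1/2"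
  \<comment> \<open>Each point slides along its meridian, its height moving linearly from -1/2 to
    \<open>z k\<close>; convexity of the interval keeps it in the band.\<close>
  define h where "h q = susp_lift k ((1 - fst q) * c + fst q * snd q k) (dirn k (snd q))"
    for q :: "real \<times> (nat \<Rightarrow> real)"
  have cd: "continuous_on ({0..1} \<times> ?B) (\<lambda>q. dirn k (snd q))"
    by (rule continuous_on_dirn[OF continuous_on_snd[OF continuous_on_id]]) (use d(2) in auto)
  have "continuous_on ({0..1} \<times> ?B) h"
    unfolding h_def susp_lift_def continuous_on_coordinatewise_iff
  proof
    fix i
    show "continuous_on ({0..1} \<times> ?B) (\<lambda>q. ((\<lambda>i. sqrt (1 - ((1 - fst q) * c + fst q * snd q k)\<^sup>2)
        * dirn k (snd q) i)(k := (1 - fst q) * c + fst q * snd q k)) i)"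
      by (cases "i = k")
        (auto intro!: continuous_on_mult continuous_on_add continuous_on_diff continuous_on_power
          continuous_on_real_sqrt continuous_on_const continuous_on_fst continuous_on_id
          continuous_on_coord[OF continuous_on_snd[OF continuous_on_id]] continuous_on_coord[OF cd])
  qed
  then show "homotopic_with_canon (\<lambda>_. True) ?B ?B (susp_lift k (-1/2) \<circ> dirn k) id"
  proof (rule homotopic_with_canonI)
    fix t :: real and z assume t: "0 \<le> t" "t \<le> 1" and z: "z \<in> ?B"
    have c: "-1 < c" "c < 0" by (simp_all add: c_def)
    have "-1 < (1 - t) * c + t * z k" "(1 - t) * c + t * z k < 0"
      using convex_bound_lt[of "-z k" 1 "-c" t "1 - t"] convex_bound_lt[of "z k" 0 c t "1 - t"] t z c
      by (auto simp: add.commute)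
    then show "h (t, z) \<in> ?B" using l(1)[OF d(1)[OF z]] by (simp add: h_def)
  qed (auto simp: h_def c_def susp_def susp_lift_dirn)
qed

text \<open>The differences are written in the shape produced by the excision axiom, with total set
  \<open>UNIV\<close>, relative set \<open>suspU k\<close> and the closed upper half
  excised.\<close>

abbreviation suspU :: "nat \<Rightarrow> (nat \<Rightarrow> real) set" where "suspU k \<equiv> {z. -1 < z k}"
abbreviation suspL :: "nat \<Rightarrow> (nat \<Rightarrow> real) set" where "suspL k \<equiv> UNIV - {z. 0 \<le> z k}"
abbreviation suspM :: "nat \<Rightarrow> (nat \<Rightarrow> real) set" where "suspM k \<equiv> {z. -1 < z k} - {z. 0 \<le> z k}"

abbreviation lower_part :: "nat \<Rightarrow> (nat \<Rightarrow> real) set \<Rightarrow> (nat \<Rightarrow> real) topology" where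
  "lower_part k X \<equiv> subtopology (top_of_set (susp k X)) (suspL k)"

text \<open>With \<open>U = suspU k\<close> the complement of the south pole and \<open>L\<close> the open lower half of \<open>\<Sigma>X\<close>, this is
  \<open>H\<^sub>p\<^sub>+\<^sub>1(\<Sigma>X) \<rightarrow> H\<^sub>p\<^sub>+\<^sub>1(\<Sigma>X, U) \<leftarrow> H\<^sub>p\<^sub>+\<^sub>1(L, L \<inter> U) \<rightarrow> H\<^sub>p(L \<inter> U) \<rightarrow> H\<^sub>p(X)\<close>, where the
  second arrow is excision and the last one the projection \<open>L \<inter> U \<simeq> X\<close>. All sets are described by the
  height \<open>z k\<close> alone, which \<open>susp_map\<close> preserves.\<close>

definition susp_hom :: "int \<Rightarrow> nat \<Rightarrow> (nat \<Rightarrow> real) set \<Rightarrow> (nat \<Rightarrow> real) chain set \<Rightarrow> (nat \<Rightarrow> real) chain set" where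
  "susp_hom p k X =
     hom_induced p (subtopology (lower_part k X) (suspM k)) {} (top_of_set X) {} (dirn k) \<circ>
     (hom_boundary (p + 1) (lower_part k X) (suspM k) \<circ>
     (inv_into (carrier (relative_homology_group (p + 1) (lower_part k X) (suspM k)))
        (hom_induced (p + 1) (lower_part k X) (suspM k) (top_of_set (susp k X)) (suspU k) id) \<circ>
      hom_induced (p + 1) (top_of_set (susp k X)) {} (top_of_set (susp k X)) (suspU k) id))"

lemma middle_part:
  "subtopology (lower_part k X) (suspM k) = top_of_set {z \<in> susp k X. -1 < z k \<and> z k < 0}"
  by (auto simp: subtopology_subtopology intro!: arg_cong[where f = top_of_set])

text \<open>By continuity of the height, the excised half is closed and the complement of the south
  pole is open; heights at least 0 exceed -1.\<close>

lemma susp_excision: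
  "hom_induced q (lower_part k X) (suspM k) (top_of_set (susp k X)) (suspU k) id
   \<in> iso (relative_homology_group q (lower_part k X) (suspM k))
         (relative_homology_group q (top_of_set (susp k X)) (suspU k))"
proof -
  let ?A = "top_of_set (susp k X)"
  have c: "continuous_map ?A euclideanreal (\<lambda>z. z k)"
    by (auto intro: continuous_on_coord[OF continuous_on_id])
  have "closedin ?A {z \<in> topspace ?A. z k \<in> {0..}}"
    by (rule closedin_continuous_map_preimage[OF c]) simp
  then have "?A closure_of {z. 0 \<le> z k} \<subseteq> {z \<in> topspace ?A. z k \<in> {0..}}"
    by (subst closure_of_restrict, intro closure_of_minimal) auto
  moreover have "openin ?A {z \<in> topspace ?A. z k \<in> {-1<..}}"
    by (rule openin_continuous_map_preimage[OF c]) simp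
  then have "{z \<in> topspace ?A. z k \<in> {-1<..}} \<subseteq> ?A interior_of {z. -1 < z k}"
    by (intro interior_of_maximal) auto
  ultimately have "?A closure_of {z. 0 \<le> z k} \<subseteq> ?A interior_of {z. -1 < z k}"
    by force
  from homology_excision_axiom[OF this subset_UNIV, of q] show ?thesis by simp
qed

text \<open>Contractibility of \<open>U\<close> makes the first arrow an isomorphism, and that of
  \<open>L\<close> makes the boundary map one. Both facts concern reduced homology; the conditions
  on \<open>p\<close> put all groups in nonzero degrees, where reduced and ordinary groups agree.
  Nonemptiness of \<open>X\<close> makes the band nonempty.\<close>

lemma susp_hom_iso:
  assumes X: "X \<subseteq> usphere k" "X \<noteq> {}" and p: "p \<noteq> 0" "p + 1 \<noteq> 0"
  shows "susp_hom p k X \<in> iso (homology_group (p + 1) (top_of_set (susp k X))) (homology_group p (top_of_set X))"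
  unfolding susp_hom_def
proof (intro iso_set_trans)
  let ?A = "top_of_set (susp k X)"
  have "contractible_space (subtopology ?A (suspU k))"
    using contractible_susp_upper[of k X] by (simp add: subtopology_subtopology Int_def)
  moreover have "pole k 1 \<in> topspace ?A \<inter> suspU k"
    using pole_in_susp[of 1 k X] by (simp add: pole_def)
  then have "topspace ?A \<inter> suspU k \<noteq> {}" by blast
  ultimately show "hom_induced (p + 1) ?A {} ?A (suspU k) id
      \<in> iso (homology_group (p + 1) ?A) (relative_homology_group (p + 1) ?A (suspU k))"
    using iso_reduced_homology_by_contractible[of ?A "suspU k" "p + 1"] p
    by (simp add: un_reduced_homology_group)
  show "inv_into (carrier (relative_homology_group (p + 1) (lower_part k X) (suspM k)))
     (hom_induced (p + 1) (lower_part k X) (suspM k) ?A (suspU k) id)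
    \<in> iso (relative_homology_group (p + 1) ?A (suspU k)) (relative_homology_group (p + 1) (lower_part k X) (suspM k))"
    by (intro group.iso_set_sym susp_excision) simp
  obtain x where "x \<in> X" using X by blast
  then have "susp_lift k (-1/2) x \<in> topspace (lower_part k X) \<inter> suspM k"
    using susp_lift_in_susp[OF X(1), of x "-1/2"] by simp
  then have "topspace (lower_part k X) \<inter> suspM k \<noteq> {}" by blast
  moreover have "contractible_space (lower_part k X)"
  proof -
    have "lower_part k X = top_of_set {z \<in> susp k X. z k < 0}"
      by (auto simp: subtopology_subtopology intro!: arg_cong[where f = top_of_set])
    then show ?thesis using contractible_susp_lower by simp
  qed
  ultimately show "hom_boundary (p + 1) (lower_part k X) (suspM k)
    \<in> iso (relative_homology_group (p + 1) (lower_part k X) (suspM k))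
          (homology_group p (subtopology (lower_part k X) (suspM k)))"
    using iso_relative_homology_of_contractible[of "lower_part k X" "suspM k" "p + 1"] p
    by (simp add: un_reduced_homology_group)
  show "hom_induced p (subtopology (lower_part k X) (suspM k)) {} (top_of_set X) {} (dirn k)
    \<in> iso (homology_group p (subtopology (lower_part k X) (suspM k))) (homology_group p (top_of_set X))"
    unfolding middle_part by (rule iso_dirn[OF X(1)])
qed

text \<open>Because \<open>susp_map\<close> preserves heights, it is a map of every pair in the
  zigzag, and each arrow commutes with it. The last square commutes already on points, as
  \<open>dirn l\<close> after \<open>susp_map k l f\<close> is \<open>f\<close> after
  \<open>dirn k\<close> on the band.\<close>

lemma susp_hom_natural:
  assumes f: "continuous_map (top_of_set X) (top_of_set Y) f"
    and X: "X \<subseteq> usphere k" and Y: "Y \<subseteq> usphere l"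
    and z: "z \<in> carrier (homology_group (p + 1) (top_of_set (susp k X)))"
  shows "susp_hom p l Y (hom_induced (p + 1) (top_of_set (susp k X)) {} (top_of_set (susp l Y)) {} (susp_map k l f) z)
       = hom_induced p (top_of_set X) {} (top_of_set Y) {} f (susp_hom p k X z)"
proof -
  let ?F = "susp_map k l f" and ?A = "top_of_set (susp k X)" and ?A' = "top_of_set (susp l Y)"
  let ?b = "hom_induced (p + 1) (lower_part k X) (suspM k) ?A (suspU k) id"
  let ?b' = "hom_induced (p + 1) (lower_part l Y) (suspM l) ?A' (suspU l) id"
  let ?R = "relative_homology_group (p + 1) (lower_part k X) (suspM k)"
  let ?R' = "relative_homology_group (p + 1) (lower_part l Y) (suspM l)"
  have F: "continuous_map ?A ?A' ?F" by (rule continuous_map_susp_map[OF f Y])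
  have FL: "continuous_map (lower_part k X) (lower_part l Y) ?F"
    using F by (auto simp: continuous_map_in_subtopology continuous_map_from_subtopology)
  have FM: "?F \<in> suspM k \<rightarrow> suspM l" and FU: "?F \<in> suspU k \<rightarrow> suspU l" by auto
  have idA: "continuous_map (lower_part k X) ?A id" "continuous_map (lower_part l Y) ?A' id"
    by (simp_all add: continuous_map_from_subtopology)
  define w where "w = inv_into (carrier ?R) ?b (hom_induced (p + 1) ?A {} ?A (suspU k) id z)"
  have az: "hom_induced (p + 1) ?A {} ?A (suspU k) id z \<in> ?b ` carrier ?R"
    using susp_excision[of "p + 1" k X] by (auto simp: iso_def bij_betw_def hom_induced_carrier)
  have bw: "?b w = hom_induced (p + 1) ?A {} ?A (suspU k) id z"
    unfolding w_def using az by (rule f_inv_into_f)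
  \<comment> \<open>The excision arrow points backwards. Pushing the preimage \<open>w\<close>
    forward gives a class that \<open>?b'\<close> sends to the required value, and injectivity
    identifies it with the preimage downstairs.\<close>
  define w' where "w' = hom_induced (p + 1) (lower_part k X) (suspM k) (lower_part l Y) (suspM l) ?F w"
  have "hom_induced (p + 1) ?A' {} ?A' (suspU l) id (hom_induced (p + 1) ?A {} ?A' {} ?F z)
      = hom_induced (p + 1) ?A (suspU k) ?A' (suspU l) ?F (hom_induced (p + 1) ?A {} ?A (suspU k) id z)"
    using F FU by (simp add: hom_induced_compose')
  also have "\<dots> = ?b' w'"
    using F FU FL FM idA unfolding w'_def bw[symmetric] by (simp add: hom_induced_compose')
  finally have "inv_into (carrier ?R') ?b' (hom_induced (p + 1) ?A' {} ?A' (suspU l) id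
       (hom_induced (p + 1) ?A {} ?A' {} ?F z)) = w'"
    using susp_excision[of "p + 1" l Y] by (simp add: iso_def bij_betw_def w'_def hom_induced_carrier)
  moreover have "hom_boundary (p + 1) (lower_part l Y) (suspM l) w' =
     hom_induced p (subtopology (lower_part k X) (suspM k)) {} (subtopology (lower_part l Y) (suspM l)) {} ?F
       (hom_boundary (p + 1) (lower_part k X) (suspM k) w)"
    using naturality_hom_induced[OF FL FM, of "p + 1"] by (simp add: w'_def o_def fun_eq_iff)
  moreover have "hom_induced p (subtopology (lower_part l Y) (suspM l)) {} (top_of_set Y) {} (dirn l)
     (hom_induced p (subtopology (lower_part k X) (suspM k)) {} (subtopology (lower_part l Y) (suspM l)) {} ?F c)
    = hom_induced p (top_of_set X) {} (top_of_set Y) {} f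
     (hom_induced p (subtopology (lower_part k X) (suspM k)) {} (top_of_set X) {} (dirn k) c)" for c
  proof -
    let ?B = "{z \<in> susp k X. -1 < z k \<and> z k < 0}"
    let ?B' = "{z \<in> susp l Y. -1 < z l \<and> z l < 0}"
    have d: "continuous_map (top_of_set {z \<in> susp k X. -1 < z k \<and> z k < 0}) (top_of_set X) (dirn k)" for k X
      using susp_nrm_nonzero[of _ k X] by (auto intro!: continuous_on_dirn[OF continuous_on_id] simp: susp_def)
    have FB: "continuous_map (top_of_set ?B) (top_of_set ?B') ?F"
      using F susp_map_in_susp[of f X Y l _ k] f Y by (auto elim: continuous_on_subset)
    have "dirn l (?F z) = f (dirn k z)" if "z \<in> ?B" for z
    proof -
      have n: "nrm k z \<noteq> 0" using that susp_nrm_nonzero[of z k X] by simp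
      then have "dirn k z \<in> X" using that by (simp add: susp_def)
      then have "f (dirn k z) \<in> usphere l" using f Y by auto
      then show ?thesis using n by (simp add: dirn_susp_map dirn_radial_ext)
    qed
    then have "hom_induced p (top_of_set ?B) {} (top_of_set Y) {} (dirn l \<circ> ?F)
      = hom_induced p (top_of_set ?B) {} (top_of_set Y) {} (f \<circ> dirn k)"
      by (intro hom_induced_eq) auto
    then show ?thesis
      unfolding middle_part by (simp add: hom_induced_compose'[OF FB _ d] hom_induced_compose'[OF d _ f])
  qed
  ultimately show ?thesis by (simp add: susp_hom_def w_def)
qed

section \<open>The linking number as a homomorphism\<close>

lemma radial_ext_cong:
  assumes "\<And>i. i < k \<Longrightarrow> x i = y i" "nrm k y \<noteq> 0 \<Longrightarrow> f (dirn k y) = g (dirn k y)"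
  shows "radial_ext k f x = radial_ext k g y"
proof -
  have "nrm k x = nrm k y" "dirn k x = dirn k y"
    using assms(1) by (auto intro: nrm_cong dirn_cong)
  then show ?thesis using assms(2) by (cases "nrm k y = 0") (auto simp: radial_ext_def)
qed

text \<open>Vectors with equal first \<open>k\<close> coordinates have equal norm and equal
  direction, so differing directions or a single vanishing norm exclude a zero.\<close>

lemma nrm_diff_nonzero:
  assumes "nrm k a \<noteq> 0 \<or> nrm k b \<noteq> 0"
    and "nrm k a \<noteq> 0 \<Longrightarrow> nrm k b \<noteq> 0 \<Longrightarrow> dirn k a \<noteq> dirn k b"
  shows "nrm k (\<lambda>i. a i - b i) \<noteq> 0"
proof
  assume "nrm k (\<lambda>i. a i - b i) = 0"
  then have "a i = b i" if "i < k" for i using that by (simp add: nrm_eq_0_iff)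
  then have "nrm k a = nrm k b" "dirn k a = dirn k b" by (auto intro: nrm_cong dirn_cong)
  then show False using assms by auto
qed

lemma nrm_add_sq: "(nrm (k + l) x)\<^sup>2 = (nrm k x)\<^sup>2 + (nrm l (\<lambda>i. x (i + k)))\<^sup>2"
  by (induction l) (simp_all add: nrm_sq add.commute)

lemma cone_curve_eq: "cone_curve \<alpha> = radial_ext 2 \<alpha>"
proof -
  have n: "plane_norm u = nrm 2 u" for u
    by (simp add: plane_norm_def nrm_def numeral_2_eq_2)
  have "(\<lambda>k. if k \<le> 1 then u k / nrm 2 u else 0) = dirn 2 u" for u
    unfolding dirn_def by (intro ext if_cong) linarith+
  then show ?thesis
    by (simp only: cone_curve_def radial_ext_def n fun_eq_iff simp_thms)
qed

text \<open>\<open>dirn 4\<close> cuts off the coordinates from 4 on, which \<open>gauss_map\<close>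
  keeps; for curves in S^3 they are 0 anyway.\<close>

lemma gauss_map_eq:
  assumes "\<alpha> \<in> usphere 2 \<rightarrow> usphere 4" "\<beta> \<in> usphere 2 \<rightarrow> usphere 4"
  shows "gauss_map \<alpha> \<beta> x = dirn 4 (\<lambda>i. radial_ext 2 \<alpha> x i - radial_ext 2 \<beta> (\<lambda>k. x (k + 2)) i)" (is "_ = dirn 4 ?D")
proof -
  have "radial_ext 2 f y i = 0" if "f \<in> usphere 2 \<rightarrow> usphere 4" "i \<ge> 4" for f y i
  proof (cases "nrm 2 y = 0")
    case False
    then have "f (dirn 2 y) \<in> usphere 4" using that dirn_in_usphere by blast
    then show ?thesis using that by (simp add: radial_ext_def usphere_def)
  qed (simp add: radial_ext_def)
  then have "?D i = 0" if "i \<ge> 4" for i using that assms by simp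
  moreover have "sqrt (\<Sum>j\<le>3. (?D j)\<^sup>2) = nrm 4 ?D"
    unfolding nrm_def using lessThan_Suc_atMost[of 3] by simp
  ultimately show ?thesis
    by (auto simp: gauss_map_def cone_curve_eq dirn_def Let_def)
qed

text \<open>On the unit sphere the radii of the two cone points cannot both be 0. If neither is,
  equal directions would give a point of the curve \<open>\<beta>\<close> in the direction of
  \<open>w\<close>, against the last assumption.\<close>

lemma nrm_radial_ext_diff_nonzero:
  assumes "w \<in> usphere (k + 2)" "\<beta> \<in> usphere 2 \<rightarrow> usphere k"
    and "nrm k w \<noteq> 0 \<Longrightarrow> dirn k w \<notin> \<beta> ` usphere 2"
  shows "nrm k (\<lambda>i. w i - radial_ext 2 \<beta> (\<lambda>j. w (j + k)) i) \<noteq> 0"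
proof (rule nrm_diff_nonzero)
  let ?v = "\<lambda>j. w (j + k)"
  have b: "nrm 2 ?v \<noteq> 0 \<Longrightarrow> dirn 2 ?v \<in> usphere 2 \<and> \<beta> (dirn 2 ?v) \<in> usphere k"
    using assms(2) dirn_in_usphere[of 2 ?v] by auto
  then have n: "nrm k (radial_ext 2 \<beta> ?v) = nrm 2 ?v" by (intro nrm_radial_ext) auto
  have "(nrm k w)\<^sup>2 + (nrm 2 ?v)\<^sup>2 = 1"
    using assms(1) nrm_add_sq[of k 2 w] by (simp add: usphere_def)
  then show "nrm k w \<noteq> 0 \<or> nrm k (radial_ext 2 \<beta> ?v) \<noteq> 0" using n by auto
  show "dirn k w \<noteq> dirn k (radial_ext 2 \<beta> ?v)" if "nrm k w \<noteq> 0" "nrm k (radial_ext 2 \<beta> ?v) \<noteq> 0"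
    using assms(3) that b n by (auto simp: dirn_radial_ext)
qed

text \<open>The map \<open>G\<^sub>\<beta>\<close>: coordinates 0 to 3 of a point of \<open>\<Sigma>\<^sup>2X\<close> span the cone on \<open>X\<close>, coordinates 4
  and 5 are the two suspension coordinates.\<close>

definition join_map :: "((nat \<Rightarrow> real) \<Rightarrow> nat \<Rightarrow> real) \<Rightarrow> (nat \<Rightarrow> real) \<Rightarrow> nat \<Rightarrow> real" where
  "join_map \<beta> w = dirn 4 (\<lambda>i. w i - radial_ext 2 \<beta> (\<lambda>k. w (k + 4)) i)"

lemma continuous_on_diff_coordinatewise:
  fixes f g :: "'a::topological_space \<Rightarrow> nat \<Rightarrow> real"
  assumes "continuous_on S f" "continuous_on S g"
  shows "continuous_on S (\<lambda>x i. f x i - g x i)"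
  unfolding continuous_on_coordinatewise_iff
  by (intro allI continuous_on_diff continuous_on_coord assms)

lemma continuous_on_shift:
  fixes f :: "'a::topological_space \<Rightarrow> nat \<Rightarrow> real"
  assumes "continuous_on S f"
  shows "continuous_on S (\<lambda>x i. f x (i + k))"
  unfolding continuous_on_coordinatewise_iff by (intro allI continuous_on_coord assms)

lemma continuous_map_join_map:
  assumes X: "X \<subseteq> usphere 4" and \<beta>: "continuous_map (top_of_set (usphere 2)) (top_of_set (usphere 4)) \<beta>"
    and disj: "X \<inter> \<beta> ` usphere 2 = {}"
  shows "continuous_map (top_of_set (susp 5 (susp 4 X))) (top_of_set (usphere 4)) (join_map \<beta>)"
proof -
  let ?S = "susp 5 (susp 4 X)"
  have b: "\<beta> \<in> usphere 2 \<rightarrow> usphere 4" "continuous_on (usphere 2) \<beta>" using \<beta> by auto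
  have nz: "nrm 4 (\<lambda>i. w i - radial_ext 2 \<beta> (\<lambda>k. w (k + 4)) i) \<noteq> 0" if w: "w \<in> ?S" for w
  proof (rule nrm_radial_ext_diff_nonzero[OF _ b(1)])
    show "w \<in> usphere (4 + 2)" using w susp_subset_usphere[of 5 "susp 4 X"] by auto
    \<comment> \<open>Membership over \<open>X\<close> is unwound one suspension at a time; a point
      off the inner axis is also off the outer one, and the two directions compose to
      \<open>dirn 4 w\<close>.\<close>
    assume n: "nrm 4 w \<noteq> 0"
    have "nrm 4 w \<le> nrm 5 w" by (rule nrm_mono) simp
    then have n5: "nrm 5 w \<noteq> 0" using n nrm_nonneg[of 4 w] by linarith
    then have "dirn 5 w \<in> susp 4 X" using w by (simp add: susp_def)
    moreover have "nrm 4 (dirn 5 w) \<noteq> 0" using n n5 by (simp add: nrm_dirn)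
    ultimately have "dirn 4 (dirn 5 w) \<in> X" by (simp add: susp_def)
    then show "dirn 4 w \<notin> \<beta> ` usphere 2" using disj n5 by (auto simp: dirn_dirn)
  qed
  have "continuous_on ?S (\<lambda>w. radial_ext 2 \<beta> (\<lambda>k. w (k + 4)))"
  proof (rule continuous_on_radial_ext[where F = "\<lambda>_. \<beta>" and l = 4])
    show "continuous_on ?S (\<lambda>w k. w (k + 4))"
      by (rule continuous_on_shift[OF continuous_on_id])
    show "continuous_on {w \<in> ?S. nrm 2 (\<lambda>k. w (k + 4)) \<noteq> 0} (\<lambda>w. \<beta> (dirn 2 (\<lambda>k. w (k + 4))))"
      by (rule continuous_on_compose2[OF b(2) continuous_on_dirn[OF continuous_on_shift[OF continuous_on_id]]])
        (auto intro: dirn_in_usphere)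
  qed (use b dirn_in_usphere in blast)
  then have "continuous_on ?S (join_map \<beta>)"
    unfolding join_map_def
    by (intro continuous_on_dirn[OF continuous_on_diff_coordinatewise[OF continuous_on_id]] nz)
  moreover have "join_map \<beta> w \<in> usphere 4" if "w \<in> ?S" for w
    unfolding join_map_def by (rule dirn_in_usphere[OF nz[OF that]])
  ultimately show ?thesis by auto
qed

text \<open>In the source, coordinates 2 and 3 are the suspension coordinates; they become 4 and 5.
  The outer suspension evaluates the inner one at \<open>dirn 3 x\<close> and multiplies by
  \<open>nrm 3 x\<close>, which cancels by homogeneity.\<close>

lemma double_susp_map:
  assumes "x \<in> usphere 4"
  shows "i < 4 \<Longrightarrow> susp_map 3 5 (susp_map 2 4 \<alpha>) x i = radial_ext 2 \<alpha> x i"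
    and "j < 2 \<Longrightarrow> susp_map 3 5 (susp_map 2 4 \<alpha>) x (j + 4) = x (j + 2)"
proof -
  have n: "nrm 2 x = 0" if "nrm 3 x = 0"
    using that nrm_mono[of 2 3 x] nrm_nonneg[of 2 x] by simp
  show "susp_map 3 5 (susp_map 2 4 \<alpha>) x i = radial_ext 2 \<alpha> x i" if "i < 4"
    using that n by (cases "nrm 3 x = 0") (simp_all add: susp_map_def radial_ext_def nrm_dirn dirn_dirn)
  show "susp_map 3 5 (susp_map 2 4 \<alpha>) x (j + 4) = x (j + 2)" if "j < 2"
  proof (cases "j = 0")
    case True
    then show ?thesis
      using nrm_mult_dirn[of 2 3 x] by (simp add: susp_map_def radial_ext_def flip: numeral_2_eq_2)
  next
    case False
    then have "j = 1" using that by simp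
    then show ?thesis by (simp add: susp_map_def del: One_nat_def)
  qed
qed

lemma join_map_double_susp_map:
  assumes "x \<in> usphere 4" "\<alpha> \<in> usphere 2 \<rightarrow> usphere 4" "\<beta> \<in> usphere 2 \<rightarrow> usphere 4"
  shows "join_map \<beta> (susp_map 3 5 (susp_map 2 4 \<alpha>) x) = gauss_map \<alpha> \<beta> x"
proof -
  have "radial_ext 2 \<beta> (\<lambda>k. susp_map 3 5 (susp_map 2 4 \<alpha>) x (k + 4)) = radial_ext 2 \<beta> (\<lambda>k. x (k + 2))"
    by (rule radial_ext_cong) (simp_all only: double_susp_map[OF assms(1)])
  then show ?thesis
    unfolding join_map_def gauss_map_eq[OF assms(2,3)]
    by (auto intro!: dirn_cong simp: double_susp_map[OF assms(1)])
qed

text \<open>\<open>nsphere\<close> counts dimensions and \<open>usphere\<close> coordinates, whence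
  the shift by one. The second form is what the simplifier makes of the first.\<close>

lemma nsphere_1: "nsphere 1 = top_of_set (usphere 2)" "nsphere (Suc 0) = top_of_set (usphere 2)"
  and nsphere_3: "nsphere 3 = top_of_set (usphere 4)"
  by (simp_all add: nsphere_eq_usphere numeral_eq_Suc)

lemma susp_susp_circle: "susp 3 (susp 2 (usphere 2)) = usphere 4"
  using susp_usphere[of 2] susp_usphere[of 3] by (simp add: numeral_eq_Suc)

text \<open>The factorisation is applied with \<open>X\<close> the image of \<open>\<alpha>\<close>
  itself, so that disjointness of the curves is the disjointness required of
  \<open>join_map \<beta>\<close>.\<close>

lemma continuous_map_gauss_map:
  assumes \<alpha>: "continuous_map (nsphere 1) (nsphere 3) \<alpha>" and \<beta>: "continuous_map (nsphere 1) (nsphere 3) \<beta>"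
    and disj: "\<alpha> ` topspace (nsphere 1) \<inter> \<beta> ` topspace (nsphere 1) = {}"
  shows "continuous_map (nsphere 3) (nsphere 3) (gauss_map \<alpha> \<beta>)"
proof -
  let ?X = "\<alpha> ` usphere 2"
  have a: "continuous_map (top_of_set (usphere 2)) (top_of_set ?X) \<alpha>" and X: "?X \<subseteq> usphere 4"
    using \<alpha> by (auto simp: nsphere_1 nsphere_3)
  have b: "continuous_map (top_of_set (usphere 2)) (top_of_set (usphere 4)) \<beta>"
    using \<beta> by (simp add: nsphere_1 nsphere_3)
  have "continuous_map (top_of_set (usphere 4)) (top_of_set (susp 5 (susp 4 ?X))) (susp_map 3 5 (susp_map 2 4 \<alpha>))"
    using continuous_map_susp_map[OF continuous_map_susp_map[OF a X, of 2], of 5 3]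
      susp_subset_usphere[of 4 ?X] by (simp add: susp_susp_circle)
  moreover have "continuous_map (top_of_set (susp 5 (susp 4 ?X))) (top_of_set (usphere 4)) (join_map \<beta>)"
    using disj by (intro continuous_map_join_map X b) (simp add: nsphere_1)
  ultimately have "continuous_map (top_of_set (usphere 4)) (top_of_set (usphere 4))
      (join_map \<beta> \<circ> susp_map 3 5 (susp_map 2 4 \<alpha>))"
    by (rule continuous_map_compose)
  then show ?thesis
    unfolding nsphere_3
    using a b X by (elim continuous_map_eq) (auto intro!: join_map_double_susp_map)
qed

text \<open>The first homology of the circle is cyclic, so the choice operator has a witness; it is
  nontrivial, so no generator is the unit.\<close>

lemma circle_generator_nontrivial:
  "circle_generator \<in> carrier (homology_group 1 (nsphere 1))"
  "circle_generator \<noteq> \<one>\<^bsub>homology_group 1 (nsphere 1)\<^esub>"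
proof -
  let ?G = "homology_group 1 (nsphere 1)"
  interpret group ?G by simp
  have red: "reduced_homology_group 1 (nsphere 1) = ?G" by (simp add: un_reduced_homology_group)
  obtain a where a: "a \<in> carrier ?G" "subgroup_generated ?G {a} = ?G"
    using cyclic_reduced_homology_group_nsphere[of 1 1] unfolding red cyclic_group_def by blast
  have "a \<in> carrier ?G \<and> generate ?G {a} = carrier ?G"
    using a carrier_subgroup_generated[of ?G "{a}"] by simp
  then have c: "circle_generator \<in> carrier ?G \<and> generate ?G {circle_generator} = carrier ?G"
    unfolding circle_generator_def by (rule someI)
  then show "circle_generator \<in> carrier ?G" by simp
  show "circle_generator \<noteq> \<one>\<^bsub>?G\<^esub>"
  proof
    assume "circle_generator = \<one>\<^bsub>?G\<^esub>"
    then have "carrier ?G = {\<one>\<^bsub>?G\<^esub>}" using c generate_one by simp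
    then have "trivial_group ?G" by (simp add: trivial_group_def)
    then show False
      using trivial_reduced_homology_group_nsphere[of 1 1] unfolding red by simp
  qed
qed

text \<open>The homomorphism is: undo two suspensions, apply the map induced by
  \<open>join_map \<beta>\<close>, and identify H_3(S^3) with the integers. The quantifier order
  matters: \<open>\<epsilon>\<close> is fixed before \<open>X\<close> and
  \<open>\<beta>\<close>.\<close>

lemma linking_number_hom:
  obtains \<epsilon> :: int where "\<epsilon> \<noteq> 0"
    and "\<And>X \<beta>. X \<subseteq> usphere 4 \<Longrightarrow> X \<noteq> {} \<Longrightarrow> continuous_map (nsphere 1) (nsphere 3) \<beta> \<Longrightarrow>
       X \<inter> \<beta> ` topspace (nsphere 1) = {} \<Longrightarrow>
       \<exists>\<Psi> \<in> hom (homology_group 1 (top_of_set X)) integer_group.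
         \<forall>\<alpha>. continuous_map (nsphere 1) (top_of_set X) \<alpha> \<longrightarrow>
           \<Psi> (hom_induced 1 (nsphere 1) {} (top_of_set X) {} \<alpha> circle_generator) = \<epsilon> * linking_number \<alpha> \<beta>"
proof -
  define H where "H X = homology_group 3 (top_of_set (susp 5 (susp 4 X)))" for X
  define \<sigma> where "\<sigma> X = susp_hom 1 4 X \<circ> susp_hom 2 5 (susp 4 X)" for X
  define \<sigma>0 where "\<sigma>0 = susp_hom 1 2 (usphere 2) \<circ> susp_hom 2 3 (susp 2 (usphere 2))"
  have susp_ne: "susp k X \<noteq> {}" for k X using pole_in_susp[of 1 k X] by auto
  have u2: "usphere 2 \<noteq> {}"
    using in_topspace_nsphere[of 1] by (auto simp: nsphere_1)
  have \<sigma>: "\<sigma> X \<in> iso (H X) (homology_group 1 (top_of_set X))" if "X \<subseteq> usphere 4" "X \<noteq> {}" for X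
    unfolding \<sigma>_def H_def
    using susp_hom_iso[OF that, of 1] susp_hom_iso[of "susp 4 X" 5 2] susp_subset_usphere[of 4 X] susp_ne
    by (intro iso_set_trans[where H = "homology_group 2 (top_of_set (susp 4 X))"]) auto
  have \<sigma>0: "\<sigma>0 \<in> iso (homology_group 3 (nsphere 3)) (homology_group 1 (nsphere 1))"
    unfolding \<sigma>0_def nsphere_1 nsphere_3
    using susp_hom_iso[of "usphere 2" 2 1] susp_hom_iso[of "susp 2 (usphere 2)" 3 2]
      susp_subset_usphere[of 2 "usphere 2"] susp_ne u2
    by (intro iso_set_trans[where H = "homology_group 2 (top_of_set (susp 2 (usphere 2)))"])
       (auto simp: susp_susp_circle)
  let ?S3 = "homology_group 3 (nsphere 3)" and ?S1 = "homology_group 1 (nsphere 1)"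
  have "\<sigma>0 ` carrier ?S3 = carrier ?S1" using \<sigma>0 unfolding iso_def bij_betw_def by blast
  then have "circle_generator \<in> \<sigma>0 ` carrier ?S3" using circle_generator_nontrivial(1) by (simp only:)
  \<comment> \<open>The class \<open>z\<close> is the double suspension of the chosen orientation of
    the circle, and \<open>\<iota> z\<close> will be \<open>\<epsilon>\<close>.\<close>
  then obtain z where z: "z \<in> carrier ?S3" "\<sigma>0 z = circle_generator" by blast
  have red: "reduced_homology_group 3 (nsphere 3) = ?S3" by (simp add: un_reduced_homology_group)
  obtain \<iota> where \<iota>: "\<iota> \<in> iso ?S3 integer_group"
    using reduced_homology_group_nsphere(1)[of 3] by (auto simp: red is_iso_def)
  interpret \<iota>: group_hom ?S3 integer_group \<iota>
    using \<iota> by (auto simp: group_hom_def group_hom_axioms_def iso_def)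
  have "\<iota> z \<noteq> 0"
  proof
    assume "\<iota> z = 0"
    then have "\<iota> z = \<iota> \<one>\<^bsub>?S3\<^esub>" using \<iota>.hom_one by simp
    moreover have "inj_on \<iota> (carrier ?S3)" using \<iota> by (simp add: iso_def bij_betw_def)
    ultimately have "z = \<one>\<^bsub>?S3\<^esub>" using z(1) \<iota>.G.one_closed by (metis inj_onD)
    moreover have "\<sigma>0 \<one>\<^bsub>?S3\<^esub> = \<one>\<^bsub>?S1\<^esub>"
      by (rule hom_one) (use \<sigma>0 in \<open>simp_all add: iso_def\<close>)
    ultimately have "circle_generator = \<one>\<^bsub>?S1\<^esub>" using z(2) by metis
    then show False using circle_generator_nontrivial(2) by simp
  qed
  moreover have "\<exists>\<Psi> \<in> hom (homology_group 1 (top_of_set X)) integer_group.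
         \<forall>\<alpha>. continuous_map (nsphere 1) (top_of_set X) \<alpha> \<longrightarrow>
           \<Psi> (hom_induced 1 (nsphere 1) {} (top_of_set X) {} \<alpha> circle_generator) = \<iota> z * linking_number \<alpha> \<beta>"
    if X: "X \<subseteq> usphere 4" "X \<noteq> {}" and \<beta>: "continuous_map (nsphere 1) (nsphere 3) \<beta>"
      and disj: "X \<inter> \<beta> ` topspace (nsphere 1) = {}" for X \<beta>
  proof (intro bexI allI impI)
    let ?SX = "top_of_set (susp 5 (susp 4 X))"
    let ?G = "hom_induced 3 ?SX {} (nsphere 3) {} (join_map \<beta>)"
    let ?\<Psi> = "\<iota> \<circ> (?G \<circ> inv_into (carrier (H X)) (\<sigma> X))"
    have jm: "continuous_map ?SX (nsphere 3) (join_map \<beta>)"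
      unfolding nsphere_3 by (rule continuous_map_join_map) (use \<beta> disj X in \<open>simp_all add: nsphere_1 nsphere_3\<close>)
    have "inv_into (carrier (H X)) (\<sigma> X) \<in> hom (homology_group 1 (top_of_set X)) (H X)"
      using group.iso_set_sym[OF _ \<sigma>[OF X]] by (simp add: H_def iso_def)
    moreover have "?G \<in> hom (H X) ?S3" by (simp add: H_def hom_induced_hom)
    moreover have "\<iota> \<in> hom ?S3 integer_group" using \<iota> by (simp add: iso_def)
    ultimately show "?\<Psi> \<in> hom (homology_group 1 (top_of_set X)) integer_group"
      by (intro hom_compose)
    fix \<alpha> assume "continuous_map (nsphere 1) (top_of_set X) \<alpha>"
    then have \<alpha>: "continuous_map (top_of_set (usphere 2)) (top_of_set X) \<alpha>" by (simp add: nsphere_1)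
    let ?F1 = "susp_map 2 4 \<alpha>" and ?F = "susp_map 3 5 (susp_map 2 4 \<alpha>)"
    have F1: "continuous_map (top_of_set (susp 2 (usphere 2))) (top_of_set (susp 4 X)) ?F1"
      by (rule continuous_map_susp_map[OF \<alpha> X(1)])
    have F: "continuous_map (nsphere 3) ?SX ?F"
      using continuous_map_susp_map[OF F1, of 5 3] susp_subset_usphere[of 4 X]
      by (simp add: susp_susp_circle nsphere_3)
    let ?y = "hom_induced 3 (nsphere 3) {} ?SX {} ?F z"
    have z2: "susp_hom 2 3 (susp 2 (usphere 2)) z \<in> carrier (homology_group 2 (top_of_set (susp 2 (usphere 2))))"
      using susp_hom_iso[of "susp 2 (usphere 2)" 3 2] susp_subset_usphere[of 2 "usphere 2"] susp_ne z(1)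
      by (auto simp: iso_def hom_def nsphere_3 susp_susp_circle)
    \<comment> \<open>Naturality, once for each suspension: the suspended curve takes
      \<open>z\<close> to the class that desuspends to the class of \<open>\<alpha>\<close>.\<close>
    have "\<sigma> X ?y = hom_induced 1 (top_of_set (usphere 2)) {} (top_of_set X) {} \<alpha> (\<sigma>0 z)"
      unfolding \<sigma>_def \<sigma>0_def nsphere_3 o_def
      using susp_hom_natural[OF F1, of 3 5 z 2] susp_hom_natural[OF \<alpha>, of 2 4 _ 1] z2 X(1)
        susp_subset_usphere[of 2 "usphere 2"] susp_subset_usphere[of 4 X] z(1)
      by (simp add: susp_susp_circle nsphere_3)
    then have "\<sigma> X ?y = hom_induced 1 (nsphere 1) {} (top_of_set X) {} \<alpha> circle_generator"
      by (simp add: z nsphere_1)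
    moreover have "inj_on (\<sigma> X) (carrier (H X))"
      using \<sigma>[OF X] unfolding iso_def bij_betw_def by blast
    moreover have "?y \<in> carrier (H X)" by (simp add: H_def hom_induced_carrier)
    ultimately have inv: "inv_into (carrier (H X)) (\<sigma> X)
        (hom_induced 1 (nsphere 1) {} (top_of_set X) {} \<alpha> circle_generator) = ?y"
      by (intro inv_into_f_eq)
    have "?G ?y = hom_induced 3 (nsphere 3) {} (nsphere 3) {} (join_map \<beta> \<circ> ?F) z"
      by (rule hom_induced_compose'[OF F _ jm]) auto
    also have "\<dots> = hom_induced 3 (nsphere 3) {} (nsphere 3) {} (gauss_map \<alpha> \<beta>) z"
    proof -
      have "join_map \<beta> (?F x) = gauss_map \<alpha> \<beta> x" if "x \<in> topspace (nsphere 3)" for x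
        using that \<alpha> X(1) \<beta> by (intro join_map_double_susp_map) (auto simp: nsphere_1 nsphere_3)
      then show ?thesis by (intro fun_cong[OF hom_induced_eq]) auto
    qed
    \<comment> \<open>The degree enters here: a self-map of S^3 acts on H_3 as the power by its
      degree, and \<open>\<iota>\<close> turns the power into a product.\<close>
    also have "\<dots> = z [^]\<^bsub>?S3\<^esub> linking_number \<alpha> \<beta>"
      using Brouwer_degree2[of z 3 "gauss_map \<alpha> \<beta>"] z(1) by (simp add: red linking_number_def)
    finally show "?\<Psi> (hom_induced 1 (nsphere 1) {} (top_of_set X) {} \<alpha> circle_generator) = \<iota> z * linking_number \<alpha> \<beta>"
      unfolding o_def inv using z(1) by (simp add: \<iota>.hom_int_pow)
  qed
  ultimately show thesis using that by blast
qed

section \<open>Symmetry and isotopy invariance of the linking number\<close>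

lemma linking_number_cong:
  assumes "\<And>s. s \<in> topspace (nsphere 1) \<Longrightarrow> \<alpha> s = \<alpha>' s" "\<And>s. s \<in> topspace (nsphere 1) \<Longrightarrow> \<beta> s = \<beta>' s"
  shows "linking_number \<alpha> \<beta> = linking_number \<alpha>' \<beta>'"
proof -
  have "radial_ext 2 \<alpha> u = radial_ext 2 \<alpha>' u" "radial_ext 2 \<beta> u = radial_ext 2 \<beta>' u" for u
    using assms by (auto intro!: radial_ext_cong simp: nsphere_1 dirn_in_usphere)
  then have "gauss_map \<alpha> \<beta> x = gauss_map \<alpha>' \<beta>' x" for x
    by (simp add: gauss_map_def cone_curve_eq)
  then show ?thesis
    unfolding linking_number_def by (intro Brouwer_degree2_eq)
qed

lemma gauss_map_nonzero:
  assumes x: "x \<in> usphere 4" and \<alpha>: "\<alpha> \<in> usphere 2 \<rightarrow> usphere 4" and \<beta>: "\<beta> \<in> usphere 2 \<rightarrow> usphere 4"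
    and disj: "\<alpha> ` usphere 2 \<inter> \<beta> ` usphere 2 = {}"
  shows "nrm 4 (\<lambda>i. radial_ext 2 \<alpha> x i - radial_ext 2 \<beta> (\<lambda>k. x (k + 2)) i) \<noteq> 0"
proof (rule nrm_diff_nonzero)
  let ?v = "\<lambda>k. x (k + 2)"
  have a: "\<alpha> (dirn 2 u) \<in> usphere 4" "\<beta> (dirn 2 u) \<in> usphere 4" if "nrm 2 u \<noteq> 0" for u
    using dirn_in_usphere[OF that] \<alpha> \<beta> by auto
  then have n: "nrm 4 (radial_ext 2 \<alpha> u) = nrm 2 u" "nrm 4 (radial_ext 2 \<beta> u) = nrm 2 u" for u
    by (auto intro!: nrm_radial_ext)
  have "(nrm 2 x)\<^sup>2 + (nrm 2 ?v)\<^sup>2 = 1"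
    using x nrm_add_sq[of 2 2 x] by (simp add: usphere_def)
  then show "nrm 4 (radial_ext 2 \<alpha> x) \<noteq> 0 \<or> nrm 4 (radial_ext 2 \<beta> ?v) \<noteq> 0" unfolding n by auto
  show "dirn 4 (radial_ext 2 \<alpha> x) \<noteq> dirn 4 (radial_ext 2 \<beta> ?v)"
    if "nrm 4 (radial_ext 2 \<alpha> x) \<noteq> 0" "nrm 4 (radial_ext 2 \<beta> ?v) \<noteq> 0"
    using that disj a dirn_in_usphere[of 2 x] dirn_in_usphere[of 2 ?v] unfolding n by (auto simp: dirn_radial_ext)
qed

text \<open>Injectivity of each stage keeps the moved curves disjoint, so the difference of their
  cones never vanishes and normalising it gives a homotopy through maps into the sphere.\<close>

lemma linking_number_isotopy:
  fixes H :: "real \<times> (nat \<Rightarrow> real) \<Rightarrow> nat \<Rightarrow> real"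
  assumes H: "continuous_map (prod_topology (top_of_set {0..1}) (nsphere 3)) (nsphere 3) H"
    and inj: "\<And>t. t \<in> {0..1} \<Longrightarrow> inj_on (\<lambda>x. H (t, x)) (topspace (nsphere 3))"
    and \<alpha>: "continuous_map (nsphere 1) (nsphere 3) \<alpha>" and \<beta>: "continuous_map (nsphere 1) (nsphere 3) \<beta>"
    and disj: "\<alpha> ` topspace (nsphere 1) \<inter> \<beta> ` topspace (nsphere 1) = {}"
  shows "linking_number (\<lambda>s. H (0, \<alpha> s)) (\<lambda>s. H (0, \<beta> s)) = linking_number (\<lambda>s. H (1, \<alpha> s)) (\<lambda>s. H (1, \<beta> s))"
proof -
  have H': "continuous_on ({0..1} \<times> usphere 4) H" "H \<in> ({0..1} \<times> usphere 4) \<rightarrow> usphere 4"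
    using H by (simp_all add: nsphere_3)
  have a: "continuous_on (usphere 2) \<alpha>" "\<alpha> \<in> usphere 2 \<rightarrow> usphere 4"
    and b: "continuous_on (usphere 2) \<beta>" "\<beta> \<in> usphere 2 \<rightarrow> usphere 4"
    using \<alpha> \<beta> by (simp_all add: nsphere_1 nsphere_3)
  let ?S = "{0..1::real} \<times> usphere 4"
  let ?c = "\<lambda>f q u. radial_ext 2 (\<lambda>s. H (fst q, f s)) u"
  let ?h = "\<lambda>q. dirn 4 (\<lambda>i. ?c \<alpha> q (snd q) i - ?c \<beta> q (\<lambda>k. snd q (k + 2)) i)"
  have Hc: "continuous_on ?S (\<lambda>q. ?c f q (u q))"
    if f: "continuous_on (usphere 2) f" "f \<in> usphere 2 \<rightarrow> usphere 4" and u: "continuous_on ?S u" for f u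
  proof (rule continuous_on_radial_ext[where F = "\<lambda>q s. H (fst q, f s)" and l = 4, OF u])
    let ?T = "{q \<in> ?S. nrm 2 (u q) \<noteq> 0}"
    have d: "continuous_on ?T (\<lambda>q. dirn 2 (u q))"
      by (rule continuous_on_dirn[OF continuous_on_subset[OF u]]) auto
    have "continuous_on ?T (\<lambda>q. f (dirn 2 (u q)))"
      by (rule continuous_on_compose2[OF f(1) d]) (auto intro: dirn_in_usphere)
    then have "continuous_on ?T (\<lambda>q. (fst q, f (dirn 2 (u q))))"
      by (intro continuous_on_Pair continuous_on_fst continuous_on_id)
    then show "continuous_on ?T (\<lambda>q. H (fst q, f (dirn 2 (u q))))"
    proof (rule continuous_on_compose2[OF H'(1)])
      show "(\<lambda>q. (fst q, f (dirn 2 (u q)))) ` ?T \<subseteq> ?S"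
        using f(2) dirn_in_usphere by (auto simp: Pi_iff)
    qed
    fix q assume q: "q \<in> ?S" "nrm 2 (u q) \<noteq> 0"
    then have "f (dirn 2 (u q)) \<in> usphere 4" using f(2) dirn_in_usphere by blast
    then show "H (fst q, f (dirn 2 (u q))) \<in> usphere 4" using H'(2) q(1) by (cases q) auto
  qed
  have maps: "(\<lambda>s. H (t, f s)) \<in> usphere 2 \<rightarrow> usphere 4" if "f \<in> usphere 2 \<rightarrow> usphere 4" "t \<in> {0..1}" for f t
    using that H'(2) by (auto simp: Pi_iff)
  have nz: "nrm 4 (\<lambda>i. radial_ext 2 (\<lambda>s. H (t, \<alpha> s)) x i - radial_ext 2 (\<lambda>s. H (t, \<beta> s)) (\<lambda>k. x (k + 2)) i) \<noteq> 0"
    if "t \<in> {0..1}" "x \<in> usphere 4" for t x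
  proof (rule gauss_map_nonzero[OF that(2) maps maps])
    have "H (t, \<alpha> s) \<noteq> H (t, \<beta> s')" if s: "s \<in> usphere 2" "s' \<in> usphere 2" for s s'
    proof
      assume "H (t, \<alpha> s) = H (t, \<beta> s')"
      then have "\<alpha> s = \<beta> s'"
        using inj_onD[OF inj[OF \<open>t \<in> {0..1}\<close>], of "\<alpha> s" "\<beta> s'"] s a(2) b(2) by (auto simp: nsphere_3)
      then show False using disj s by (auto simp: nsphere_1)
    qed
    then show "(\<lambda>s. H (t, \<alpha> s)) ` usphere 2 \<inter> (\<lambda>s. H (t, \<beta> s)) ` usphere 2 = {}" by auto
  qed (use a b that in auto)
  have "homotopic_with_canon (\<lambda>_. True) (usphere 4) (usphere 4)
      (gauss_map (\<lambda>s. H (0, \<alpha> s)) (\<lambda>s. H (0, \<beta> s))) (gauss_map (\<lambda>s. H (1, \<alpha> s)) (\<lambda>s. H (1, \<beta> s)))"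
  proof (rule homotopic_with_canonI[where h = ?h])
    have s: "continuous_on ?S snd" by (intro continuous_on_snd continuous_on_id)
    show "continuous_on ?S ?h"
      by (intro continuous_on_dirn continuous_on_diff_coordinatewise Hc a b s continuous_on_shift[OF s])
        (use nz in auto)
  qed (use nz maps[OF a(2)] maps[OF b(2)] in \<open>auto simp: gauss_map_eq intro: dirn_in_usphere\<close>)
  then show ?thesis
    unfolding linking_number_def by (intro Brouwer_degree2_homotopic) (simp add: nsphere_3)
qed

text \<open>Exchanging the curves amounts to exchanging the two planes in the source
  (\<open>R\<close>) and applying the antipode in the target (\<open>N\<close>). Both are
  involutions of the sphere, so their degrees square to 1 and the sign is the product of the two
  degrees.\<close>

lemma linking_number_commute:
  obtains s :: int where "s * s = 1"
    and "\<And>\<alpha> \<beta>. continuous_map (nsphere 1) (nsphere 3) \<alpha> \<Longrightarrow> continuous_map (nsphere 1) (nsphere 3) \<beta> \<Longrightarrow>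
      \<alpha> ` topspace (nsphere 1) \<inter> \<beta> ` topspace (nsphere 1) = {} \<Longrightarrow>
      linking_number \<beta> \<alpha> = s * linking_number \<alpha> \<beta>"
proof -
  define N where "N = (\<lambda>x::nat \<Rightarrow> real. \<lambda>i. - x i)"
  define R where "R = (\<lambda>x::nat \<Rightarrow> real. \<lambda>i. if i < 2 then x (i + 2) else if i < 4 then x (i - 2) else 0)"
  have sq: "(nrm 4 x)\<^sup>2 = (nrm 2 x)\<^sup>2 + (nrm 2 (\<lambda>k. x (k + 2)))\<^sup>2" for x
    using nrm_add_sq[of 2 2 x] by simp
  have u: "x \<in> usphere 4 \<longleftrightarrow> (nrm 4 x)\<^sup>2 = 1 \<and> (\<forall>i\<ge>4. x i = 0)" for x
    using nrm_nonneg[of 4 x] by (auto simp: usphere_def power2_eq_1_iff simp del: nrm_nonneg)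
  have R1: "nrm 2 (R x) = nrm 2 (\<lambda>k. x (k + 2))" "nrm 2 (\<lambda>k. R x (k + 2)) = nrm 2 x" for x
    by (auto simp: R_def intro: nrm_cong)
  have RS: "R x \<in> usphere 4" if "x \<in> usphere 4" for x
    using that unfolding u sq R1 by (auto simp: R_def)
  have NS: "N x \<in> usphere 4" if "x \<in> usphere 4" for x
    using that nrm_scale[of 4 "-1" x] by (auto simp: N_def usphere_def)
  have Rc: "continuous_map (nsphere 3) (nsphere 3) R"
  proof -
    have "continuous_on (usphere 4) (\<lambda>x. R x i)" for i
      by (cases "i < 2"; cases "i < 4") (auto simp: R_def intro: continuous_on_coord[OF continuous_on_id])
    then show ?thesis using RS by (auto simp: nsphere_3 continuous_on_coordinatewise_iff[of _ R])
  qed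
  have Nc: "continuous_map (nsphere 3) (nsphere 3) N"
  proof -
    have "continuous_on (usphere 4) (\<lambda>x. N x i)" for i
      by (auto simp: N_def intro!: continuous_on_minus continuous_on_coord[OF continuous_on_id])
    then show ?thesis using NS by (auto simp: nsphere_3 continuous_on_coordinatewise_iff[of _ N])
  qed
  have "R (R x) i = x i" if "x \<in> usphere 4" for x i
    using that by (cases "i < 2"; cases "i < 4") (auto simp: R_def usphere_def simp del: add_2_eq_Suc')
  then have "Brouwer_degree2 3 (R \<circ> R) = Brouwer_degree2 3 id"
    by (intro Brouwer_degree2_eq) (auto simp: nsphere_3 fun_eq_iff)
  then have R2: "Brouwer_degree2 3 R * Brouwer_degree2 3 R = 1"
    by (simp add: Brouwer_degree2_compose[OF Rc Rc])
  have "Brouwer_degree2 3 (N \<circ> N) = Brouwer_degree2 3 id"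
    by (rule Brouwer_degree2_eq) (auto simp: N_def)
  then have N2: "Brouwer_degree2 3 N * Brouwer_degree2 3 N = 1"
    by (simp add: Brouwer_degree2_compose[OF Nc Nc])
  show thesis
  proof
    show "(Brouwer_degree2 3 N * Brouwer_degree2 3 R) * (Brouwer_degree2 3 N * Brouwer_degree2 3 R) = 1"
      using R2 N2 by (metis mult.assoc mult.left_commute mult_1_right)
    fix \<alpha> \<beta>
    assume \<alpha>: "continuous_map (nsphere 1) (nsphere 3) \<alpha>" and \<beta>: "continuous_map (nsphere 1) (nsphere 3) \<beta>"
      and disj: "\<alpha> ` topspace (nsphere 1) \<inter> \<beta> ` topspace (nsphere 1) = {}"
    have a: "\<alpha> \<in> usphere 2 \<rightarrow> usphere 4" "\<beta> \<in> usphere 2 \<rightarrow> usphere 4"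
      using \<alpha> \<beta> by (simp_all add: nsphere_1 nsphere_3)
    note G = continuous_map_gauss_map[OF \<alpha> \<beta> disj]
    have "gauss_map \<beta> \<alpha> x = (N \<circ> (gauss_map \<alpha> \<beta> \<circ> R)) x" for x
    proof -
      have 1: "radial_ext 2 \<alpha> (R x) = radial_ext 2 \<alpha> (\<lambda>k. x (k + 2))" "radial_ext 2 \<beta> (\<lambda>k. R x (k + 2)) = radial_ext 2 \<beta> x"
        by (rule radial_ext_cong; simp add: R_def)+
      have "dirn 4 (\<lambda>i. - D i) = N (dirn 4 D)" for D
        using nrm_scale[of 4 "-1" D] by (auto simp: dirn_def N_def)
      from this[of "\<lambda>i. radial_ext 2 \<alpha> (\<lambda>k. x (k + 2)) i - radial_ext 2 \<beta> x i"]
      show ?thesis unfolding o_def gauss_map_eq[OF a(1,2)] gauss_map_eq[OF a(2,1)] 1 by simp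
    qed
    then have "linking_number \<beta> \<alpha> = Brouwer_degree2 3 (N \<circ> (gauss_map \<alpha> \<beta> \<circ> R))"
      unfolding linking_number_def by (intro Brouwer_degree2_eq)
    also have "\<dots> = Brouwer_degree2 3 N * (linking_number \<alpha> \<beta> * Brouwer_degree2 3 R)"
      by (simp add: Brouwer_degree2_compose Rc Nc G continuous_map_compose[OF Rc G] linking_number_def)
    finally show "linking_number \<beta> \<alpha> = (Brouwer_degree2 3 N * Brouwer_degree2 3 R) * linking_number \<alpha> \<beta>"
      by simp
  qed
qed

section \<open>Elementary divisors of equivalent matrices\<close>

text \<open>\<open>invertible_mat\<close> leaves the size of the inverse open; it is recovered by
  comparing dimensions in the two products.\<close>

lemma invertible_mat_iff:
  assumes "A \<in> carrier_mat n n"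
  shows "invertible_mat A \<longleftrightarrow> (\<exists>B \<in> carrier_mat n n. A * B = 1\<^sub>m n \<and> B * A = 1\<^sub>m n)"
proof
  assume "invertible_mat A"
  then obtain B where B: "A * B = 1\<^sub>m n" "B * A = 1\<^sub>m (dim_row B)"
    using assms by (auto simp: invertible_mat_def inverts_mat_def)
  have "dim_col (A * B) = n" "dim_col (B * A) = dim_row B" using B by auto
  then have "B \<in> carrier_mat n n" using assms by auto
  then show "\<exists>B \<in> carrier_mat n n. A * B = 1\<^sub>m n \<and> B * A = 1\<^sub>m n" using B by auto
qed (use assms in \<open>auto simp: invertible_mat_def inverts_mat_def\<close>)

lemma invertible_mat_mult:
  assumes A: "(A :: 'a::comm_ring_1 mat) \<in> carrier_mat n n" "invertible_mat A"
    and B: "B \<in> carrier_mat n n" "invertible_mat B"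
  shows "invertible_mat (A * B)"
proof -
  obtain A' where A': "A' \<in> carrier_mat n n" "A * A' = 1\<^sub>m n" "A' * A = 1\<^sub>m n"
    using A invertible_mat_iff by blast
  obtain B' where B': "B' \<in> carrier_mat n n" "B * B' = 1\<^sub>m n" "B' * B = 1\<^sub>m n"
    using B invertible_mat_iff by blast
  have c: "A * B \<in> carrier_mat n n" "B' * A' \<in> carrier_mat n n" using A B A' B' by auto
  have "B * (B' * A') = A'" "A' * (A * B) = B"
    using assoc_mult_mat[of B n n B' n A' n] assoc_mult_mat[of A' n n A n B n] A B A' B' by simp_all
  then have "A * B * (B' * A') = 1\<^sub>m n" "B' * A' * (A * B) = 1\<^sub>m n"
    using A' B' by (simp_all only: assoc_mult_mat[OF A(1) B(1) c(2)] assoc_mult_mat[OF B'(1) A'(1) c(1)])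
  then show ?thesis
    using c invertible_mat_iff[OF c(1)] by blast
qed

lemma invertible_mat_transpose:
  assumes A: "(A :: 'a::comm_ring_1 mat) \<in> carrier_mat n n" "invertible_mat A"
  shows "invertible_mat A\<^sup>T"
proof -
  obtain A' where A': "A' \<in> carrier_mat n n" "A * A' = 1\<^sub>m n" "A' * A = 1\<^sub>m n"
    using A invertible_mat_iff by blast
  then have "A\<^sup>T * A'\<^sup>T = 1\<^sub>m n" "A'\<^sup>T * A\<^sup>T = 1\<^sub>m n"
    using A by (metis transpose_mult transpose_one)+
  then show ?thesis
    using A A' invertible_mat_iff[of "A\<^sup>T" n] by (metis transpose_carrier_mat)
qed

lemma smith_form_of_iff:
  assumes "M \<in> carrier_mat m n"
  shows "smith_form_of M D \<longleftrightarrow>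
     (\<exists>P \<in> carrier_mat m m. \<exists>Q \<in> carrier_mat n n. invertible_mat P \<and> invertible_mat Q \<and> D = P * M * Q)
   \<and> diagonal_mat D \<and> (\<forall>i. Suc i < min m n \<longrightarrow> D $$ (i, i) dvd D $$ (Suc i, Suc i))"
proof -
  have "dim_row M = m" "dim_col M = n" using assms by auto
  then show ?thesis unfolding smith_form_of_def by blast
qed

lemma smith_form_of_equivalent:
  assumes M: "M \<in> carrier_mat m n" and P: "P \<in> carrier_mat m m" "invertible_mat P"
    and Q: "Q \<in> carrier_mat n n" "invertible_mat Q" and D: "smith_form_of (P * M * Q) D"
  shows "smith_form_of M D"
proof -
  have M': "P * M * Q \<in> carrier_mat m n" using P M Q by simp
  from D obtain P1 Q1 where 1: "P1 \<in> carrier_mat m m" "invertible_mat P1" "Q1 \<in> carrier_mat n n" "invertible_mat Q1"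
      "D = P1 * (P * M * Q) * Q1"
    unfolding smith_form_of_iff[OF M'] by blast
  have "P * M * Q * Q1 = P * M * (Q * Q1)"
    by (rule assoc_mult_mat[of _ m n _ n _ n]) (use M P Q 1 in auto)
  also have "\<dots> = P * (M * (Q * Q1))"
    by (rule assoc_mult_mat[of _ m m _ n _ n]) (use M P Q 1 in auto)
  finally have "P1 * (P * M * Q * Q1) = P1 * (P * (M * (Q * Q1)))" by simp
  also have "\<dots> = P1 * P * (M * (Q * Q1))"
    by (rule assoc_mult_mat[of _ m m _ m _ n, symmetric]) (use M P Q 1 in auto)
  also have "\<dots> = P1 * P * M * (Q * Q1)"
    by (rule assoc_mult_mat[of _ m m _ n _ n, symmetric]) (use M P Q 1 in auto)
  also have "P1 * (P * M * Q * Q1) = D"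
    unfolding 1(5) by (rule assoc_mult_mat[of _ m m _ n _ n, symmetric]) (use M P Q 1 in auto)
  finally have "D = P1 * P * M * (Q * Q1)" .
  moreover have "invertible_mat (P1 * P)" "invertible_mat (Q * Q1)"
    using P Q 1 by (auto intro: invertible_mat_mult)
  moreover have "P1 * P \<in> carrier_mat m m" "Q * Q1 \<in> carrier_mat n n" using P Q 1 by auto
  ultimately show ?thesis
    using D unfolding smith_form_of_iff[OF M'] smith_form_of_iff[OF M] by blast
qed

text \<open>Equivalence can be undone with the inverse matrices, so both matrices have the same
  Smith forms, and the definite description depends only on these.\<close>

lemma elementary_divisors_equivalent:
  assumes M: "M \<in> carrier_mat m n" and P: "P \<in> carrier_mat m m" "invertible_mat P"
    and Q: "Q \<in> carrier_mat n n" "invertible_mat Q"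
  shows "elementary_divisors (P * M * Q) = elementary_divisors M"
proof -
  obtain P' where P': "P' \<in> carrier_mat m m" "P * P' = 1\<^sub>m m" "P' * P = 1\<^sub>m m"
    using P invertible_mat_iff by blast
  obtain Q' where Q': "Q' \<in> carrier_mat n n" "Q * Q' = 1\<^sub>m n" "Q' * Q = 1\<^sub>m n"
    using Q invertible_mat_iff by blast
  have N: "P * M * Q \<in> carrier_mat m n" using P M Q by simp
  have "P' * (P * M * Q) = P' * (P * M) * Q"
    by (rule assoc_mult_mat[of _ m m _ n _ n, symmetric]) (use M P Q P' in auto)
  also have "P' * (P * M) = M"
    using assoc_mult_mat[of P' m m P m M n] P P' M by simp
  finally have "P' * (P * M * Q) * Q' = M"
    using assoc_mult_mat[of M m n Q n Q' n] Q Q' M by simp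
  moreover have "invertible_mat P'" "invertible_mat Q'"
    using P' Q' P Q by (auto simp: invertible_mat_iff)
  ultimately have "smith_form_of (P * M * Q) D = smith_form_of M D" for D
    using smith_form_of_equivalent[OF M P Q, of D] smith_form_of_equivalent[OF N P'(1) _ Q'(1), of D] by auto
  then show ?thesis by (simp add: elementary_divisors_def)
qed

lemma smith_form_of_transpose:
  assumes D: "smith_form_of M D"
  shows "smith_form_of M\<^sup>T D\<^sup>T"
proof -
  define m n where "m = dim_row M" and "n = dim_col M"
  have M: "M \<in> carrier_mat m n" by (auto simp: m_def n_def)
  from D obtain P Q where 1: "P \<in> carrier_mat m m" "invertible_mat P" "Q \<in> carrier_mat n n" "invertible_mat Q"
      "D = P * M * Q"
    unfolding smith_form_of_iff[OF M] by blast
  have Dc: "D \<in> carrier_mat m n" using 1 M by simp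
  have "D\<^sup>T = Q\<^sup>T * (P * M)\<^sup>T"
    unfolding 1(5) by (rule transpose_mult[of _ m n _ n]) (use 1 M in auto)
  also have "(P * M)\<^sup>T = M\<^sup>T * P\<^sup>T" by (rule transpose_mult[of _ m m _ n]) (use 1 M in auto)
  also have "Q\<^sup>T * (M\<^sup>T * P\<^sup>T) = Q\<^sup>T * M\<^sup>T * P\<^sup>T"
    by (rule assoc_mult_mat[of _ n n _ m _ m, symmetric]) (use 1 M in auto)
  finally have "D\<^sup>T = Q\<^sup>T * M\<^sup>T * P\<^sup>T" .
  moreover have "diagonal_mat D\<^sup>T"
    using D Dc unfolding smith_form_of_iff[OF M] diagonal_mat_def by auto
  moreover have "D\<^sup>T $$ (i, i) dvd D\<^sup>T $$ (Suc i, Suc i)" if "Suc i < min n m" for i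
    using D Dc that unfolding smith_form_of_iff[OF M] by auto
  moreover have "Q\<^sup>T \<in> carrier_mat n n" "P\<^sup>T \<in> carrier_mat m m" and Mt: "M\<^sup>T \<in> carrier_mat n m"
    using 1 M by simp_all
  moreover have "invertible_mat Q\<^sup>T" "invertible_mat P\<^sup>T"
    using invertible_mat_transpose 1 by blast+
  ultimately show ?thesis unfolding smith_form_of_iff[OF Mt] by blast
qed

lemma abs_nonzero_diag_transpose: "abs_nonzero_diag D\<^sup>T = abs_nonzero_diag D"
proof -
  let ?I = "{i. i < min (dim_row D) (dim_col D) \<and> D $$ (i, i) \<noteq> 0}"
  have I: "{i. i < min (dim_row D\<^sup>T) (dim_col D\<^sup>T) \<and> D\<^sup>T $$ (i, i) \<noteq> 0} = ?I"
    by auto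
  have "finite ?I" by simp
  then have "image_mset (\<lambda>i. \<bar>D\<^sup>T $$ (i, i)\<bar>) (mset_set ?I) = image_mset (\<lambda>i. \<bar>D $$ (i, i)\<bar>) (mset_set ?I)"
    by (intro image_mset_cong) (simp only: elem_mset_set, simp)
  then show ?thesis
    unfolding abs_nonzero_diag_def I .
qed

lemma elementary_divisors_transpose: "elementary_divisors M\<^sup>T = elementary_divisors M"
proof -
  have "(\<exists>D. smith_form_of M\<^sup>T D \<and> E = abs_nonzero_diag D) \<longleftrightarrow> (\<exists>D. smith_form_of M D \<and> E = abs_nonzero_diag D)" for E
    by (metis smith_form_of_transpose abs_nonzero_diag_transpose transpose_transpose)
  then show ?thesis by (simp add: elementary_divisors_def)
qed

text \<open>Multiplication by \<open>s\<close> is multiplication by the matrix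
  \<open>s \<cdot>\<^sub>m 1\<^sub>m m\<close>, which is its own inverse.\<close>

lemma elementary_divisors_sign:
  fixes s :: int
  assumes "s * s = 1"
  shows "elementary_divisors (s \<cdot>\<^sub>m M) = elementary_divisors M"
proof -
  define m n where "m = dim_row M" and "n = dim_col M"
  have M: "M \<in> carrier_mat m n" by (auto simp: m_def n_def)
  let ?P = "s \<cdot>\<^sub>m 1\<^sub>m m"
  have "?P * ?P = 1\<^sub>m m"
    using assms by (auto simp: mult_smult_distrib[of _ m m _ m] mult_smult_assoc_mat[of _ m m _ m])
  then have "invertible_mat ?P"
    by (auto simp: invertible_mat_iff[of _ m] intro!: bexI[of _ ?P])
  moreover have "?P * M * 1\<^sub>m n = s \<cdot>\<^sub>m M"
    using M by (simp add: mult_smult_assoc_mat[of _ m m _ n])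
  moreover have "invertible_mat (1\<^sub>m n :: int mat)"
    by (auto simp: invertible_mat_iff[of _ n] intro!: bexI[of _ "1\<^sub>m n"])
  ultimately show ?thesis
    using elementary_divisors_equivalent[OF M, of ?P "1\<^sub>m n"] by simp
qed

section \<open>Change of basis\<close>

lemma hom_finprod:
  assumes "comm_group G" "comm_group H" "\<phi> \<in> hom G H" "finite A" "f \<in> A \<rightarrow> carrier G"
  shows "\<phi> (finprod G f A) = finprod H (\<lambda>i. \<phi> (f i)) A"
proof -
  interpret G: comm_group G by fact
  interpret H: comm_group H by fact
  interpret group_hom G H \<phi>
    using assms(3) by (simp add: group_hom_def group_hom_axioms_def G.is_group H.is_group)
  show ?thesis
    using assms(4,5) by (induction A rule: finite_induct) (auto simp: Pi_iff)
qed

lemma finprod_integer_group: "finite A \<Longrightarrow> finprod integer_group f A = sum f A"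
proof (induction A rule: finite_induct)
  interpret comm_group integer_group by (rule abelian_integer_group)
  case (insert x A)
  then show ?case by (simp add: finprod_insert)
next
  interpret comm_group integer_group by (rule abelian_integer_group)
  case empty
  show ?case by simp
qed

text \<open>The coordinate functions form the dual basis. Being homomorphisms themselves, they can
  be substituted for \<open>\<Psi>\<close> in the expansion formula, which is how change of basis is
  computed.\<close>

lemma free_abelian_basis_coordinates:
  assumes G: "comm_group G" and e: "free_abelian_basis G m e"
  obtains \<kappa> where "\<And>i. i < m \<Longrightarrow> (\<lambda>x. \<kappa> x i) \<in> hom G integer_group"
    and "\<And>i j. i < m \<Longrightarrow> j < m \<Longrightarrow> \<kappa> (e i) j = (if i = j then 1 else 0)"
    and "\<And>\<Psi> x. \<Psi> \<in> hom G integer_group \<Longrightarrow> x \<in> carrier G \<Longrightarrow> \<Psi> x = (\<Sum>i<m. \<kappa> x i * \<Psi> (e i))"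
proof -
  interpret comm_group G by fact
  define \<Phi> where "\<Phi> = (\<lambda>c :: nat \<Rightarrow> int. finprod G (\<lambda>i. e i [^]\<^bsub>G\<^esub> c i) {..<m})"
  define \<kappa> where "\<kappa> = inv_into ({..<m} \<rightarrow>\<^sub>E UNIV) \<Phi>"
  have ec: "e i \<in> carrier G" if "i < m" for i using e that by (simp add: free_abelian_basis_def)
  have bij: "bij_betw \<Phi> ({..<m} \<rightarrow>\<^sub>E UNIV) (carrier G)"
    using e by (simp add: free_abelian_basis_def \<Phi>_def)
  \<comment> \<open>The bijection is stated on extensional functions, while pointwise sums and 0-1
    vectors need not be extensional; restricting to indices below \<open>m\<close> extends
    uniqueness of coordinates to them.\<close>
  have inj: "c i = d i" if "\<Phi> c = \<Phi> d" "i < m" for c d i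
  proof -
    have "\<Phi> c = \<Phi> (restrict c {..<m})" for c
      unfolding \<Phi>_def by (rule finprod_cong') (auto intro: ec int_pow_closed)
    then have "\<Phi> (restrict c {..<m}) = \<Phi> (restrict d {..<m})" using that(1) by metis
    then have "restrict c {..<m} = restrict d {..<m}"
      by (rule inj_onD[OF bij_betw_imp_inj_on[OF bij]]) auto
    then show ?thesis using that(2) by (metis lessThan_iff restrict_apply')
  qed
  have \<kappa>: "\<Phi> (\<kappa> x) = x" if "x \<in> carrier G" for x
    using bij that unfolding \<kappa>_def bij_betw_def by (simp add: f_inv_into_f)
  have mult: "\<Phi> c \<otimes>\<^bsub>G\<^esub> \<Phi> d = \<Phi> (\<lambda>i. c i + d i)" for c d
  proof -
    have "\<Phi> (\<lambda>i. c i + d i) = finprod G (\<lambda>i. e i [^]\<^bsub>G\<^esub> c i \<otimes>\<^bsub>G\<^esub> e i [^]\<^bsub>G\<^esub> d i) {..<m}"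
      unfolding \<Phi>_def using ec by (intro finprod_cong') (auto simp: int_pow_mult)
    also have "\<dots> = \<Phi> c \<otimes>\<^bsub>G\<^esub> \<Phi> d"
      unfolding \<Phi>_def using ec by (intro finprod_multf) auto
    finally show ?thesis by simp
  qed
  have delta: "\<Phi> (\<lambda>j. if i = j then 1 else 0) = e i" if "i < m" for i
  proof -
    have "\<Phi> (\<lambda>j. if i = j then 1 else 0) = finprod G (\<lambda>j. if i = j then e j else \<one>\<^bsub>G\<^esub>) {..<m}"
      unfolding \<Phi>_def using ec by (intro finprod_cong') (auto simp: int_pow_def nat_pow_def)
    also have "\<dots> = e i" using that ec by (intro finprod_singleton) auto
    finally show ?thesis .
  qed
  show thesis
  proof
    show "(\<lambda>x. \<kappa> x i) \<in> hom G integer_group" if "i < m" for i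
    proof (rule homI)
      fix x y assume "x \<in> carrier G" "y \<in> carrier G"
      then have "\<Phi> (\<kappa> (x \<otimes>\<^bsub>G\<^esub> y)) = \<Phi> (\<lambda>i. \<kappa> x i + \<kappa> y i)" by (simp add: \<kappa> flip: mult)
      from inj[OF this that] show "\<kappa> (x \<otimes>\<^bsub>G\<^esub> y) i = \<kappa> x i \<otimes>\<^bsub>integer_group\<^esub> \<kappa> y i" by simp
    qed simp
    show "\<kappa> (e i) j = (if i = j then 1 else 0)" if "i < m" "j < m" for i j
      by (rule inj) (use that in \<open>simp_all add: \<kappa> ec delta\<close>)
    fix \<Psi> x assume \<Psi>: "\<Psi> \<in> hom G integer_group" and x: "x \<in> carrier G"
    have "\<Psi> x = \<Psi> (\<Phi> (\<kappa> x))" using x by (simp add: \<kappa>)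
    also have "\<dots> = (\<Sum>i<m. \<Psi> (e i [^]\<^bsub>G\<^esub> \<kappa> x i))"
      unfolding \<Phi>_def using ec
      by (subst hom_finprod[OF G abelian_integer_group \<Psi>]) (auto simp: finprod_integer_group)
    also have "\<dots> = (\<Sum>i<m. \<kappa> x i * \<Psi> (e i))"
      using ec hom_int_pow[OF \<Psi> _ _ group_integer_group] by (intro sum.cong) auto
    finally show "\<Psi> x = (\<Sum>i<m. \<kappa> x i * \<Psi> (e i))" .
  qed
qed

text \<open>Row \<open>i\<close> of \<open>P\<close> holds the coordinates of \<open>e' i\<close>
  with respect to \<open>e\<close>. Expanding a coordinate function of one basis in the other shows
  that the two transition matrices are mutually inverse.\<close>

lemma free_abelian_basis_change:
  assumes G: "comm_group G" and e: "free_abelian_basis G m e" and e': "free_abelian_basis G m e'"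
  obtains P :: "int mat" where "P \<in> carrier_mat m m" "invertible_mat P"
    and "\<And>\<Psi> i. \<Psi> \<in> hom G integer_group \<Longrightarrow> i < m \<Longrightarrow> \<Psi> (e' i) = (\<Sum>j<m. P $$ (i, j) * \<Psi> (e j))"
proof -
  obtain \<kappa> where \<kappa>: "\<And>i. i < m \<Longrightarrow> (\<lambda>x. \<kappa> x i) \<in> hom G integer_group"
    "\<And>i j. i < m \<Longrightarrow> j < m \<Longrightarrow> \<kappa> (e i) j = (if i = j then 1 else 0)"
    "\<And>\<Psi> x. \<Psi> \<in> hom G integer_group \<Longrightarrow> x \<in> carrier G \<Longrightarrow> \<Psi> x = (\<Sum>i<m. \<kappa> x i * \<Psi> (e i))"
    using free_abelian_basis_coordinates[OF G e] by blast
  obtain \<kappa>' where \<kappa>': "\<And>i. i < m \<Longrightarrow> (\<lambda>x. \<kappa>' x i) \<in> hom G integer_group"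
    "\<And>i j. i < m \<Longrightarrow> j < m \<Longrightarrow> \<kappa>' (e' i) j = (if i = j then 1 else 0)"
    "\<And>\<Psi> x. \<Psi> \<in> hom G integer_group \<Longrightarrow> x \<in> carrier G \<Longrightarrow> \<Psi> x = (\<Sum>i<m. \<kappa>' x i * \<Psi> (e' i))"
    using free_abelian_basis_coordinates[OF G e'] by blast
  have ec: "e i \<in> carrier G" "e' i \<in> carrier G" if "i < m" for i
    using e e' that by (simp_all add: free_abelian_basis_def)
  define P where "P = mat m m (\<lambda>(i, j). \<kappa> (e' i) j)"
  define P' where "P' = mat m m (\<lambda>(i, j). \<kappa>' (e i) j)"
  have "P * P' = 1\<^sub>m m"
  proof (rule eq_matI)
    fix i j assume ij: "i < dim_row (1\<^sub>m m :: int mat)" "j < dim_col (1\<^sub>m m :: int mat)"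
    then have "(P * P') $$ (i, j) = (\<Sum>k<m. \<kappa> (e' i) k * \<kappa>' (e k) j)"
      by (simp add: P_def P'_def scalar_prod_def atLeast0LessThan)
    also have "\<dots> = \<kappa>' (e' i) j" using \<kappa>(3)[OF \<kappa>'(1)[of j] ec(2)[of i]] ij by simp
    finally show "(P * P') $$ (i, j) = 1\<^sub>m m $$ (i, j)" using \<kappa>'(2) ij by simp
  qed (simp_all add: P_def P'_def)
  moreover have "P' * P = 1\<^sub>m m"
  proof (rule eq_matI)
    fix i j assume ij: "i < dim_row (1\<^sub>m m :: int mat)" "j < dim_col (1\<^sub>m m :: int mat)"
    then have "(P' * P) $$ (i, j) = (\<Sum>k<m. \<kappa>' (e i) k * \<kappa> (e' k) j)"
      by (simp add: P_def P'_def scalar_prod_def atLeast0LessThan)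
    also have "\<dots> = \<kappa> (e i) j" using \<kappa>'(3)[OF \<kappa>(1)[of j] ec(1)[of i]] ij by simp
    finally show "(P' * P) $$ (i, j) = 1\<^sub>m m $$ (i, j)" using \<kappa>(2) ij by simp
  qed (simp_all add: P_def P'_def)
  moreover have "P \<in> carrier_mat m m" "P' \<in> carrier_mat m m" by (simp_all add: P_def P'_def)
  ultimately have "P \<in> carrier_mat m m" "invertible_mat P" by (auto simp: invertible_mat_iff)
  moreover have "\<Psi> (e' i) = (\<Sum>j<m. P $$ (i, j) * \<Psi> (e j))" if "\<Psi> \<in> hom G integer_group" "i < m" for \<Psi> i
    using \<kappa>(3)[OF that(1) ec(2)[OF that(2)]] that(2) by (simp add: P_def)
  ultimately show thesis using that by blast
qed

lemma free_abelian_basis_iso: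
  assumes G: "comm_group G" and H: "comm_group H" and \<phi>: "\<phi> \<in> iso G H" and e: "free_abelian_basis G m e"
  shows "free_abelian_basis H m (\<lambda>i. \<phi> (e i))"
proof -
  interpret G: comm_group G by fact
  interpret H: comm_group H by fact
  have hom: "\<phi> \<in> hom G H" and bij: "bij_betw \<phi> (carrier G) (carrier H)" using \<phi> by (auto simp: iso_def)
  have ec: "e i \<in> carrier G" if "i < m" for i using e that by (simp add: free_abelian_basis_def)
  have "\<phi> (finprod G (\<lambda>i. e i [^]\<^bsub>G\<^esub> c i) {..<m}) = finprod H (\<lambda>i. \<phi> (e i) [^]\<^bsub>H\<^esub> c i) {..<m}" for c :: "nat \<Rightarrow> int"
  proof -
    have "\<phi> (finprod G (\<lambda>i. e i [^]\<^bsub>G\<^esub> c i) {..<m}) = finprod H (\<lambda>i. \<phi> (e i [^]\<^bsub>G\<^esub> c i)) {..<m}"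
      using ec by (intro hom_finprod G H hom) auto
    also have "\<dots> = finprod H (\<lambda>i. \<phi> (e i) [^]\<^bsub>H\<^esub> c i) {..<m}"
      using ec hom_int_pow[OF hom _ G.is_group H.is_group] hom by (intro H.finprod_cong') (auto simp: hom_def)
    finally show ?thesis .
  qed
  then have "bij_betw (\<lambda>c :: nat \<Rightarrow> int. finprod H (\<lambda>i. \<phi> (e i) [^]\<^bsub>H\<^esub> c i) {..<m})
      ({..<m} \<rightarrow>\<^sub>E UNIV) (carrier H)"
    using bij_betw_trans[OF _ bij, of "\<lambda>c :: nat \<Rightarrow> int. finprod G (\<lambda>i. e i [^]\<^bsub>G\<^esub> c i) {..<m}" "{..<m} \<rightarrow>\<^sub>E UNIV"] e
    by (simp add: free_abelian_basis_def o_def)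
  then show ?thesis
    using ec hom by (auto simp: free_abelian_basis_def hom_def)
qed

section \<open>The invariant\<close>

lemma in_S3_eq: "h \<subseteq> topspace S3 \<Longrightarrow> in_S3 h = top_of_set h"
  by (simp add: nsphere_3 subtopology_subtopology Int_absorb1)

text \<open>One matrix \<open>P\<close>, depending on the two bases alone, serves all curves
  \<open>\<beta>\<close>, so that it acts on the whole linking matrix from the left.\<close>

lemma linking_number_change_basis:
  assumes h: "h \<subseteq> topspace S3" and e: "represented_basis h m e \<alpha>" and e': "represented_basis h m e' \<alpha>'"
  obtains P :: "int mat" where "P \<in> carrier_mat m m" "invertible_mat P"
    and "\<And>\<beta> i. continuous_map (nsphere 1) S3 \<beta> \<Longrightarrow> h \<inter> \<beta> ` topspace (nsphere 1) = {} \<Longrightarrow> i < m \<Longrightarrow>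
      linking_number (\<alpha>' i) \<beta> = (\<Sum>j<m. P $$ (i, j) * linking_number (\<alpha> j) \<beta>)"
proof -
  let ?c = "\<lambda>\<alpha>. hom_induced 1 (nsphere 1) {} (top_of_set h) {} \<alpha> circle_generator"
  have b: "free_abelian_basis (homology_group 1 (top_of_set h)) m e"
      "free_abelian_basis (homology_group 1 (top_of_set h)) m e'"
    using e e' by (simp_all add: represented_basis_def H1_basis_def in_S3_eq[OF h])
  have r: "continuous_map (nsphere 1) (top_of_set h) (\<alpha> i)" "?c (\<alpha> i) = e i"
      "continuous_map (nsphere 1) (top_of_set h) (\<alpha>' i)" "?c (\<alpha>' i) = e' i" if "i < m" for i
    using e e' that unfolding represented_basis_def represents_def in_S3_eq[OF h] by blast+
  obtain P :: "int mat" where P: "P \<in> carrier_mat m m" "invertible_mat P"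
    "\<And>\<Psi> i. \<Psi> \<in> hom (homology_group 1 (top_of_set h)) integer_group \<Longrightarrow> i < m \<Longrightarrow>
       \<Psi> (e' i) = (\<Sum>j<m. P $$ (i, j) * \<Psi> (e j))"
    using free_abelian_basis_change[OF abelian_homology_group b] by blast
  obtain \<epsilon> :: int where \<epsilon>: "\<epsilon> \<noteq> 0"
    "\<And>X \<beta>. X \<subseteq> usphere 4 \<Longrightarrow> X \<noteq> {} \<Longrightarrow> continuous_map (nsphere 1) (nsphere 3) \<beta> \<Longrightarrow>
       X \<inter> \<beta> ` topspace (nsphere 1) = {} \<Longrightarrow>
       \<exists>\<Psi> \<in> hom (homology_group 1 (top_of_set X)) integer_group.
         \<forall>\<alpha>. continuous_map (nsphere 1) (top_of_set X) \<alpha> \<longrightarrow>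
           \<Psi> (hom_induced 1 (nsphere 1) {} (top_of_set X) {} \<alpha> circle_generator) = \<epsilon> * linking_number \<alpha> \<beta>"
    by (rule linking_number_hom, rule that)
  show thesis
  proof (rule that[OF P(1,2)])
    fix \<beta> i assume \<beta>: "continuous_map (nsphere 1) S3 \<beta>" "h \<inter> \<beta> ` topspace (nsphere 1) = {}" and i: "i < m"
    \<comment> \<open>An index \<open>i < m\<close> provides a curve in \<open>h\<close>, so
      \<open>h\<close> is nonempty as the suspension isomorphism demands.\<close>
    obtain s where "s \<in> topspace (nsphere 1)" using in_topspace_nsphere by blast
    then have "h \<noteq> {}" using r(3)[OF i] by (auto simp: nsphere_1)
    then obtain \<Psi> where \<Psi>: "\<Psi> \<in> hom (homology_group 1 (top_of_set h)) integer_group"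
      "\<And>\<alpha>. continuous_map (nsphere 1) (top_of_set h) \<alpha> \<Longrightarrow> \<Psi> (?c \<alpha>) = \<epsilon> * linking_number \<alpha> \<beta>"
      using \<epsilon>(2)[of h \<beta>] \<beta> h unfolding nsphere_3 topspace_euclidean_subtopology by blast
    have "\<epsilon> * linking_number (\<alpha>' i) \<beta> = \<Psi> (e' i)"
      using \<Psi>(2)[OF r(3)[OF i]] r(4)[OF i] by simp
    also have "\<dots> = (\<Sum>j<m. P $$ (i, j) * \<Psi> (e j))" by (rule P(3)[OF \<Psi>(1) i])
    also have "\<dots> = (\<Sum>j<m. P $$ (i, j) * (\<epsilon> * linking_number (\<alpha> j) \<beta>))"
    proof (rule sum.cong[OF refl])
      fix j assume "j \<in> {..<m}"
      then have "\<Psi> (e j) = \<epsilon> * linking_number (\<alpha> j) \<beta>"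
        using \<Psi>(2)[OF r(1)[of j]] r(2)[of j] by simp
      then show "P $$ (i, j) * \<Psi> (e j) = P $$ (i, j) * (\<epsilon> * linking_number (\<alpha> j) \<beta>)" by simp
    qed
    also have "\<dots> = \<epsilon> * (\<Sum>j<m. P $$ (i, j) * linking_number (\<alpha> j) \<beta>)"
      by (simp add: sum_distrib_left mult.left_commute)
    finally show "linking_number (\<alpha>' i) \<beta> = (\<Sum>j<m. P $$ (i, j) * linking_number (\<alpha> j) \<beta>)"
      using \<epsilon>(1) by simp
  qed
qed

lemma elementary_divisors_change_basis:
  assumes h: "h1 \<subseteq> topspace S3" "h1 \<inter> h2 = {}"
    and e: "represented_basis h1 m e \<alpha>" and e': "represented_basis h1 m e' \<alpha>'"
    and \<beta>: "\<And>j. j < n \<Longrightarrow> continuous_map (nsphere 1) (in_S3 h2) (\<beta> j)"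
  shows "elementary_divisors (linking_matrix m n \<alpha>' \<beta>) = elementary_divisors (linking_matrix m n \<alpha> \<beta>)"
proof -
  obtain P :: "int mat" where P: "P \<in> carrier_mat m m" "invertible_mat P"
    "\<And>\<beta> i. continuous_map (nsphere 1) S3 \<beta> \<Longrightarrow> h1 \<inter> \<beta> ` topspace (nsphere 1) = {} \<Longrightarrow> i < m \<Longrightarrow>
      linking_number (\<alpha>' i) \<beta> = (\<Sum>j<m. P $$ (i, j) * linking_number (\<alpha> j) \<beta>)"
    using linking_number_change_basis[OF h(1) e e'] by blast
  let ?M = "linking_matrix m n \<alpha> \<beta>"
  have M: "?M \<in> carrier_mat m n" by (simp add: linking_matrix_def)
  have "linking_matrix m n \<alpha>' \<beta> = P * ?M"
  proof (rule eq_matI)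
    fix i j assume "i < dim_row (P * ?M)" "j < dim_col (P * ?M)"
    then have ij: "i < m" "j < n" using P(1) by (simp_all add: linking_matrix_def)
    have b: "continuous_map (nsphere 1) S3 (\<beta> j)" "h1 \<inter> \<beta> j ` topspace (nsphere 1) = {}"
      using \<beta>[OF ij(2)] h(2) by (auto simp: continuous_map_in_subtopology)
    show "linking_matrix m n \<alpha>' \<beta> $$ (i, j) = (P * ?M) $$ (i, j)"
      using P(1) ij P(3)[OF b ij(1)] by (simp add: linking_matrix_def scalar_prod_def atLeast0LessThan)
  qed (use P(1) in \<open>auto simp: linking_matrix_def\<close>)
  also have "\<dots> = P * ?M * 1\<^sub>m n" using P(1) M by simp
  finally show ?thesis
    using elementary_divisors_equivalent[OF M P(1,2), of "1\<^sub>m n"]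
    by (auto simp: invertible_mat_iff[of _ n] intro!: bexI[of _ "1\<^sub>m n"])
qed

lemma disjoint_curves:
  assumes "h1 \<inter> h2 = {}" "continuous_map (nsphere 1) (in_S3 h1) \<alpha>" "continuous_map (nsphere 1) (in_S3 h2) \<beta>"
  shows "continuous_map (nsphere 1) S3 \<alpha>" "continuous_map (nsphere 1) S3 \<beta>"
    "\<alpha> ` topspace (nsphere 1) \<inter> \<beta> ` topspace (nsphere 1) = {}"
proof -
  have "\<alpha> ` topspace (nsphere 1) \<subseteq> h1" "\<beta> ` topspace (nsphere 1) \<subseteq> h2"
    using assms(2,3) by (auto simp: continuous_map_in_subtopology)
  then show "\<alpha> ` topspace (nsphere 1) \<inter> \<beta> ` topspace (nsphere 1) = {}"
    using assms(1) by blast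
qed (use assms(2,3) in \<open>auto simp: continuous_map_in_subtopology\<close>)

lemma elementary_divisors_swap:
  assumes disj: "h1 \<inter> h2 = {}"
    and \<alpha>: "\<And>i. i < m \<Longrightarrow> continuous_map (nsphere 1) (in_S3 h1) (\<alpha> i)"
    and \<beta>: "\<And>j. j < n \<Longrightarrow> continuous_map (nsphere 1) (in_S3 h2) (\<beta> j)"
  shows "elementary_divisors (linking_matrix n m \<beta> \<alpha>) = elementary_divisors (linking_matrix m n \<alpha> \<beta>)"
proof -
  obtain s :: int where s: "s * s = 1"
    "\<And>\<alpha> \<beta>. continuous_map (nsphere 1) (nsphere 3) \<alpha> \<Longrightarrow> continuous_map (nsphere 1) (nsphere 3) \<beta> \<Longrightarrow>
      \<alpha> ` topspace (nsphere 1) \<inter> \<beta> ` topspace (nsphere 1) = {} \<Longrightarrow>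
      linking_number \<beta> \<alpha> = s * linking_number \<alpha> \<beta>"
    by (rule linking_number_commute, rule that)
  have "linking_number (\<beta> j) (\<alpha> i) = s * linking_number (\<alpha> i) (\<beta> j)" if "i < m" "j < n" for i j
    by (intro s(2) disjoint_curves[OF disj \<alpha>[OF that(1)] \<beta>[OF that(2)]])
  then have "linking_matrix n m \<beta> \<alpha> = s \<cdot>\<^sub>m (linking_matrix m n \<alpha> \<beta>)\<^sup>T"
    by (intro eq_matI) (auto simp: linking_matrix_def)
  then show ?thesis
    by (simp add: elementary_divisors_sign s(1) elementary_divisors_transpose)
qed

lemma represented_basisD:
  "represented_basis h m e \<alpha> \<Longrightarrow> i < m \<Longrightarrow> continuous_map (nsphere 1) (in_S3 h) (\<alpha> i)"
  by (simp add: represented_basis_def represents_def)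

lemma Lk_wrt_swap:
  assumes "h1 \<inter> h2 = {}" "represented_basis h1 m e \<alpha>" "represented_basis h2 n f \<beta>"
  shows "Lk_wrt n m \<beta> \<alpha> = Lk_wrt m n \<alpha> \<beta>"
  using elementary_divisors_swap[OF assms(1), of m \<alpha> n \<beta>] represented_basisD assms(2,3)
  by (simp add: Lk_wrt_def)

text \<open>Only the first basis can be changed directly. Swapping the components makes the second
  basis the first, and a further swap restores the order.\<close>

lemma Lk_wrt_basis_independent:
  assumes h: "h1 \<subseteq> topspace S3" "h2 \<subseteq> topspace S3" "h1 \<inter> h2 = {}"
    and e: "represented_basis h1 m e \<alpha>" and f: "represented_basis h2 n f \<beta>"
    and e': "represented_basis h1 m e' \<alpha>'" and f': "represented_basis h2 n f' \<beta>'"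
  shows "Lk_wrt m n \<alpha> \<beta> = Lk_wrt m n \<alpha>' \<beta>'"
proof -
  have h': "h2 \<inter> h1 = {}" using h(3) by blast
  have "Lk_wrt m n \<alpha>' \<beta>' = Lk_wrt m n \<alpha> \<beta>'"
    using elementary_divisors_change_basis[OF h(1,3) e e' represented_basisD[OF f']] by (simp add: Lk_wrt_def)
  also have "\<dots> = Lk_wrt n m \<beta>' \<alpha>" by (rule Lk_wrt_swap[OF h' f' e])
  also have "\<dots> = Lk_wrt n m \<beta> \<alpha>"
    using elementary_divisors_change_basis[OF h(2) h' f f' represented_basisD[OF e]] by (simp add: Lk_wrt_def)
  also have "\<dots> = Lk_wrt m n \<alpha> \<beta>" by (rule Lk_wrt_swap[OF h(3) e f])
  finally show ?thesis by simp
qed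

text \<open>As \<^const>\<open>Lk\<close> and \<^const>\<open>elementary_divisors\<close> are definite descriptions, it is enough that the
  describing predicates agree; existence and uniqueness of the described values play no role.\<close>

definition Lk_value :: "(nat \<Rightarrow> real) set \<Rightarrow> (nat \<Rightarrow> real) set \<Rightarrow> int multiset \<Rightarrow> bool" where
  "Lk_value h1 h2 E \<longleftrightarrow> (\<exists>m n e f \<alpha> \<beta>. handlebody m h1 \<and> handlebody n h2
        \<and> represented_basis h1 m e \<alpha> \<and> represented_basis h2 n f \<beta> \<and> E = Lk_wrt m n \<alpha> \<beta>)"

lemma Lk_cong: "(\<And>E. Lk_value h1 h2 E \<longleftrightarrow> Lk_value k1 k2 E) \<Longrightarrow> Lk h1 h2 = Lk k1 k2"
  unfolding Lk_def Lk_value_def by presburger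

text \<open>Needed because an isotopy of links carries only the union to the union and may exchange
  the components.\<close>

lemma Lk_commute:
  assumes "h1 \<inter> h2 = {}"
  shows "Lk h1 h2 = Lk h2 h1"
proof (rule Lk_cong)
  have "h2 \<inter> h1 = {}" using assms by blast
  then show "Lk_value h1 h2 E \<longleftrightarrow> Lk_value h2 h1 E" for E
    unfolding Lk_value_def by (metis Lk_wrt_swap assms)
qed

section \<open>Transport along homeomorphisms of the 3-sphere\<close>

lemma homeomorphic_map_in_S3:
  assumes "homeomorphic_map S3 S3 \<psi>" "h \<subseteq> topspace S3"
  shows "homeomorphic_map (in_S3 h) (in_S3 (\<psi> ` h)) \<psi>"
  by (rule homeomorphic_map_subtopologies[OF assms(1)])
    (use assms homeomorphic_imp_surjective_map[OF assms(1)] in auto)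

lemma handlebody_image:
  assumes \<psi>: "homeomorphic_map S3 S3 \<psi>" and h: "handlebody m h"
  shows "handlebody m (\<psi> ` h)"
proof -
  have "in_S3 h homeomorphic_space in_S3 (\<psi> ` h)"
    using homeomorphic_map_in_S3[OF \<psi>] h unfolding handlebody_def
    by (meson homeomorphic_map_imp_homeomorphic_space)
  moreover have "\<psi> ` h \<subseteq> topspace S3"
    using h homeomorphic_imp_surjective_map[OF \<psi>] by (auto simp: handlebody_def)
  ultimately show ?thesis
    using h unfolding handlebody_def by (meson homeomorphic_space_sym homeomorphic_space_trans)
qed

lemma represented_basis_image:
  assumes \<psi>: "homeomorphic_map S3 S3 \<psi>" and h: "h \<subseteq> topspace S3" and e: "represented_basis h m e \<alpha>"
  shows "represented_basis (\<psi> ` h) m (\<lambda>i. hom_induced 1 (in_S3 h) {} (in_S3 (\<psi> ` h)) {} \<psi> (e i)) (\<lambda>i. \<psi> \<circ> \<alpha> i)"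
proof -
  note \<psi>h = homeomorphic_map_in_S3[OF \<psi> h]
  have c: "continuous_map (in_S3 h) (in_S3 (\<psi> ` h)) \<psi>" using \<psi>h by (rule homeomorphic_imp_continuous_map)
  have "H1_basis (\<psi> ` h) m (\<lambda>i. hom_induced 1 (in_S3 h) {} (in_S3 (\<psi> ` h)) {} \<psi> (e i))"
    using e homeomorphic_map_homology_iso[OF \<psi>h, of 1]
    by (auto simp: represented_basis_def H1_basis_def intro: free_abelian_basis_iso abelian_homology_group)
  moreover have "represents (\<psi> ` h) (\<psi> \<circ> \<alpha> i) (hom_induced 1 (in_S3 h) {} (in_S3 (\<psi> ` h)) {} \<psi> (e i))" if "i < m" for i
  proof -
    have a: "continuous_map (nsphere 1) (in_S3 h) (\<alpha> i)"
      and x: "hom_induced 1 (nsphere 1) {} (in_S3 h) {} (\<alpha> i) circle_generator = e i"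
      using e that unfolding represented_basis_def represents_def by blast+
    show ?thesis
      unfolding represents_def x[symmetric]
      using continuous_map_compose[OF a c] hom_induced_compose_empty[OF a c] by (simp only: o_apply simp_thms)
  qed
  ultimately show ?thesis by (simp add: represented_basis_def)
qed

text \<open>Quantifying over all disjoint curves in S^3, and not just those in a given link, lets
  the property pass to the inverse homeomorphism.\<close>

definition preserves_linking :: "((nat \<Rightarrow> real) \<Rightarrow> nat \<Rightarrow> real) \<Rightarrow> bool" where
  "preserves_linking \<psi> \<longleftrightarrow> (\<forall>\<alpha> \<beta>. continuous_map (nsphere 1) S3 \<alpha> \<and> continuous_map (nsphere 1) S3 \<beta> \<and>
     \<alpha> ` topspace (nsphere 1) \<inter> \<beta> ` topspace (nsphere 1) = {} \<longrightarrow>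
     linking_number (\<psi> \<circ> \<alpha>) (\<psi> \<circ> \<beta>) = linking_number \<alpha> \<beta>)"

lemma Lk_value_image:
  assumes \<psi>: "homeomorphic_map S3 S3 \<psi>" "preserves_linking \<psi>" and disj: "h1 \<inter> h2 = {}"
    and E: "Lk_value h1 h2 E"
  shows "Lk_value (\<psi> ` h1) (\<psi> ` h2) E"
proof -
  obtain m n e f \<alpha> \<beta> where 1: "handlebody m h1" "handlebody n h2"
    "represented_basis h1 m e \<alpha>" "represented_basis h2 n f \<beta>" "E = Lk_wrt m n \<alpha> \<beta>"
    using E unfolding Lk_value_def by blast
  have "linking_number (\<psi> \<circ> \<alpha> i) (\<psi> \<circ> \<beta> j) = linking_number (\<alpha> i) (\<beta> j)" if "i < m" "j < n" for i j
    using \<psi>(2) disjoint_curves[OF disj represented_basisD[OF 1(3) that(1)] represented_basisD[OF 1(4) that(2)]]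
    unfolding preserves_linking_def by blast
  then have "linking_matrix m n (\<lambda>i. \<psi> \<circ> \<alpha> i) (\<lambda>j. \<psi> \<circ> \<beta> j) = linking_matrix m n \<alpha> \<beta>"
    by (intro eq_matI) (auto simp: linking_matrix_def)
  then have "E = Lk_wrt m n (\<lambda>i. \<psi> \<circ> \<alpha> i) (\<lambda>j. \<psi> \<circ> \<beta> j)" by (simp add: 1(5) Lk_wrt_def)
  moreover have "h1 \<subseteq> topspace S3" "h2 \<subseteq> topspace S3" using 1(1,2) by (auto simp: handlebody_def)
  ultimately show ?thesis
    unfolding Lk_value_def
    using handlebody_image[OF \<psi>(1) 1(1)] handlebody_image[OF \<psi>(1) 1(2)]
      represented_basis_image[OF \<psi>(1) _ 1(3)] represented_basis_image[OF \<psi>(1) _ 1(4)] by blast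
qed

text \<open>Equality of the descriptions requires an equivalence of the describing predicates. The
  converse implication is transport along \<open>\<theta>\<close>, which preserves linking since
  \<open>\<psi>\<close> undoes it and preserves linking.\<close>

lemma Lk_image:
  assumes \<psi>: "homeomorphic_map S3 S3 \<psi>" "preserves_linking \<psi>"
    and h: "h1 \<subseteq> topspace S3" "h2 \<subseteq> topspace S3" "h1 \<inter> h2 = {}"
  shows "Lk h1 h2 = Lk (\<psi> ` h1) (\<psi> ` h2)"
proof (rule Lk_cong)
  obtain \<theta> where \<theta>: "homeomorphic_maps S3 S3 \<psi> \<theta>" using \<psi>(1) by (auto simp: homeomorphic_map_maps)
  then have \<theta>': "homeomorphic_map S3 S3 \<theta>" "\<And>x. x \<in> topspace S3 \<Longrightarrow> \<theta> (\<psi> x) = x" "\<And>x. x \<in> topspace S3 \<Longrightarrow> \<psi> (\<theta> x) = x"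
    using homeomorphic_maps_sym homeomorphic_map_maps by (blast, auto simp: homeomorphic_maps_def)
  have c: "continuous_map S3 S3 \<theta>" using \<theta>'(1) by (rule homeomorphic_imp_continuous_map)
  have "preserves_linking \<theta>"
    unfolding preserves_linking_def
  proof (intro allI impI, elim conjE)
    fix \<alpha> \<beta> assume a: "continuous_map (nsphere 1) S3 \<alpha>" and b: "continuous_map (nsphere 1) S3 \<beta>"
      and d: "\<alpha> ` topspace (nsphere 1) \<inter> \<beta> ` topspace (nsphere 1) = {}"
    have S: "\<alpha> s \<in> topspace S3" "\<beta> s \<in> topspace S3" if "s \<in> topspace (nsphere 1)" for s
      using continuous_map_image_subset_topspace[OF a] continuous_map_image_subset_topspace[OF b] that by blast+
    have "(\<theta> \<circ> \<alpha>) ` topspace (nsphere 1) \<inter> (\<theta> \<circ> \<beta>) ` topspace (nsphere 1) = {}"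
    proof (rule ccontr)
      assume "\<not> ?thesis"
      then obtain s t where st: "s \<in> topspace (nsphere 1)" "t \<in> topspace (nsphere 1)" "\<theta> (\<alpha> s) = \<theta> (\<beta> t)" by auto
      then have "\<alpha> s = \<beta> t" by (metis S \<theta>'(3))
      then show False using d st by blast
    qed
    then have "linking_number (\<theta> \<circ> \<alpha>) (\<theta> \<circ> \<beta>) = linking_number (\<psi> \<circ> (\<theta> \<circ> \<alpha>)) (\<psi> \<circ> (\<theta> \<circ> \<beta>))"
      using \<psi>(2) continuous_map_compose[OF a c] continuous_map_compose[OF b c]
      unfolding preserves_linking_def by metis
    also have "\<dots> = linking_number \<alpha> \<beta>"
      by (rule linking_number_cong) (simp_all add: S \<theta>'(3))
    finally show "linking_number (\<theta> \<circ> \<alpha>) (\<theta> \<circ> \<beta>) = linking_number \<alpha> \<beta>" .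
  qed
  moreover have inv: "\<theta> ` \<psi> ` h = h" if "h \<subseteq> topspace S3" for h
    using \<theta>'(2) that by (force simp: image_image subset_iff)
  moreover have "\<psi> ` h1 \<inter> \<psi> ` h2 = {}"
  proof -
    have "\<psi> x \<noteq> \<psi> y" if "x \<in> h1" "y \<in> h2" for x y
      using that h \<theta>'(2) by (metis disjoint_iff subsetD)
    then show ?thesis by blast
  qed
  ultimately show "Lk_value h1 h2 E \<longleftrightarrow> Lk_value (\<psi> ` h1) (\<psi> ` h2) E" for E
    using Lk_value_image[OF \<psi> h(3), of E] Lk_value_image[OF \<theta>'(1), of "\<psi> ` h1" "\<psi> ` h2" E]
    unfolding inv[OF h(1)] inv[OF h(2)] using \<psi>(2) by blast
qed

text \<open>For connectedness each point is joined to the outer circle by a vertical segment leading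
  away from the real axis. The hole centres are real, so the distance to them grows along the
  segment and no hole is entered.\<close>

lemma std_handlebody_planar:
  fixes g :: nat
  defines "P \<equiv> {z. cmod z \<le> 3 * real g + 3 \<and> (\<forall>k\<in>{1..g}. 1 \<le> cmod (z - of_nat (3 * k)))}"
  shows "compact P" "connected P" "P \<noteq> {}"
proof -
  define R where "R = 3 * real g + 3"
  have P: "P = cball 0 R \<inter> (\<Inter>k\<in>{1..g}. - ball (of_nat (3 * k)) 1)"
    by (simp add: set_eq_iff P_def R_def dist_norm norm_minus_commute not_less)
  show "compact P" unfolding P by (intro compact_Int_closed closed_INT) auto
  have sphere: "sphere 0 R \<subseteq> P"
  proof
    fix z :: complex assume "z \<in> sphere 0 R"
    then have z: "cmod z = R" by simp
    \<comment> \<open>All centres have modulus at most \<open>3 * real g\<close>, so the outer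
      circle keeps distance at least 3 from them.\<close>
    have "1 \<le> cmod (z - of_nat (3 * k))" if "k \<in> {1..g}" for k
    proof -
      have "cmod z - cmod (of_nat (3 * k)) \<le> cmod (z - of_nat (3 * k))" by (rule norm_triangle_ineq2)
      moreover have "cmod (of_nat (3 * k)) \<le> 3 * real g" using that by (simp only: norm_of_nat) simp
      ultimately show ?thesis using z unfolding R_def by linarith
    qed
    then show "z \<in> P" using z by (simp add: P_def R_def)
  qed
  have "R > 0" by (simp add: R_def)
  then have "complex_of_real R \<in> sphere 0 R" by simp
  then show "P \<noteq> {}" using sphere by blast
  define T where "T z = closed_segment z (Complex (Re z) ((if Im z \<ge> 0 then 1 else -1) * sqrt (R\<^sup>2 - (Re z)\<^sup>2)))"
    for z
  have T: "T z \<subseteq> P \<and> T z \<inter> sphere 0 R \<noteq> {} \<and> z \<in> T z" if z: "z \<in> P" for z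
  proof (intro conjI)
    \<comment> \<open>The side of the real axis on which \<open>z\<close> lies; points on the axis
      are sent upwards.\<close>
    define \<sigma> :: real where "\<sigma> = (if Im z \<ge> 0 then 1 else -1)"
    define y where "y = sqrt (R\<^sup>2 - (Re z)\<^sup>2)"
    have "(cmod z)\<^sup>2 \<le> R\<^sup>2" using z by (intro power_mono) (simp_all add: P_def R_def)
    then have zR: "(Re z)\<^sup>2 + (Im z)\<^sup>2 \<le> R\<^sup>2" by (simp add: cmod_power2)
    then have "0 \<le> R\<^sup>2 - (Re z)\<^sup>2" by (smt (verit) zero_le_power2)
    then have y: "0 \<le> y" "y\<^sup>2 = R\<^sup>2 - (Re z)\<^sup>2" by (simp_all add: y_def)
    have Im: "Im z = \<sigma> * \<bar>Im z\<bar>" "\<sigma>\<^sup>2 = 1" by (simp_all add: \<sigma>_def)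
    have "\<bar>Im z\<bar> \<le> y" by (rule power2_le_imp_le) (use zR y in simp_all)
    have Tz: "T z = closed_segment z (Complex (Re z) (\<sigma> * y))" by (simp add: T_def \<sigma>_def y_def)
    show "z \<in> T z" by (simp add: Tz)
    have "cmod (Complex (Re z) (\<sigma> * y)) = R"
      using y Im(2) \<open>R > 0\<close> by (simp add: cmod_def power_mult_distrib)
    then have "Complex (Re z) (\<sigma> * y) \<in> T z \<inter> sphere 0 R" by (simp add: Tz)
    then show "T z \<inter> sphere 0 R \<noteq> {}" by blast
    show "T z \<subseteq> P"
    proof
      fix w assume "w \<in> T z"
      then obtain t where t: "0 \<le> t" "t \<le> 1" "w = (1 - t) *\<^sub>R z + t *\<^sub>R Complex (Re z) (\<sigma> * y)"
        unfolding Tz closed_segment_def by blast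
      define c where "c = (1 - t) * \<bar>Im z\<bar> + t * y"
      have w: "Re w = Re z" "Im w = \<sigma> * c"
        using Im(1) by (auto simp: t c_def algebra_simps)
      have "\<bar>Im z\<bar> \<le> c" "c \<le> y"
        using \<open>\<bar>Im z\<bar> \<le> y\<close> t(1,2) convex_bound_le[of "\<bar>Im z\<bar>" y y "1 - t" t] convex_bound_le[of "-\<bar>Im z\<bar>" "-\<bar>Im z\<bar>" "-y" "1 - t" t]
        by (auto simp: c_def)
      then have c: "(Im z)\<^sup>2 \<le> (Im w)\<^sup>2" "(Im w)\<^sup>2 \<le> y\<^sup>2"
        using Im(2) power_mono[of "\<bar>Im z\<bar>" c 2] power_mono[of c y 2] unfolding w power_mult_distrib by simp_all
      have "cmod w \<le> R"
        by (rule power2_le_imp_le) (use c y w \<open>R > 0\<close> in \<open>simp_all add: cmod_power2\<close>)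
      moreover have "cmod (z - of_nat j) \<le> cmod (w - of_nat j)" for j
        by (rule power2_le_imp_le) (use c w in \<open>simp_all add: cmod_power2\<close>)
      then have "1 \<le> cmod (w - of_nat (3 * k))" if "k \<in> {1..g}" for k
        using z that unfolding P_def by (blast intro: order_trans)
      ultimately show "w \<in> P" unfolding P_def R_def by blast
    qed
  qed
  \<comment> \<open>Adjoining the outer circle to every segment gives connected sets with a common
    point.\<close>
  have "connected (\<Union>z\<in>P. T z \<union> sphere 0 R)"
  proof (rule connected_Union)
    show "connected S" if "S \<in> (\<lambda>z. T z \<union> sphere 0 R) ` P" for S
      using that T connected_sphere[of "0::complex" R] by (auto simp: T_def intro!: connected_Un)
    show "\<Inter> ((\<lambda>z. T z \<union> sphere 0 R) ` P) \<noteq> {}"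
      using \<open>complex_of_real R \<in> sphere 0 R\<close> by blast
  qed
  also have "(\<Union>z\<in>P. T z \<union> sphere 0 R) = P" using T sphere by blast
  finally show "connected P" .
qed

lemma compact_space_top_of_set: "compact_space (top_of_set S) \<longleftrightarrow> compact S"
  using compactin_subspace[of euclidean S] by (simp add: compactin_euclidean_iff)

lemma connected_space_top_of_set: "connected_space (top_of_set S) \<longleftrightarrow> connected S"
  using connectedin_def[of euclidean S] by (simp add: connectedin_iff_connected)

lemma handlebody_topology:
  assumes "handlebody g h"
  shows "compact h" "connected h" "h \<noteq> {}"
proof -
  have hom: "top_of_set h homeomorphic_space top_of_set (std_handlebody g)"
    using assms in_S3_eq[of h] by (simp add: handlebody_def)
  have std: "compact (std_handlebody g)" "connected (std_handlebody g)" "std_handlebody g \<noteq> {}"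
    unfolding std_handlebody_def using std_handlebody_planar[of g]
    by (auto intro!: compact_Times connected_Times)
  show "compact h" "connected h"
    using homeomorphic_compact_space[OF hom] homeomorphic_connected_space[OF hom] std(1,2)
    by (simp_all add: compact_space_top_of_set connected_space_top_of_set)
  obtain z where "z \<in> std_handlebody g" using std(3) by blast
  then show "h \<noteq> {}"
    using hom by (auto simp: homeomorphic_space_def homeomorphic_maps_def)
qed

text \<open>A connected set covered by two disjoint closed sets lies in one of them; applied in both
  directions, this turns inclusions into equalities.\<close>

lemma connected_components_unique:
  fixes A B C D :: "'a::topological_space set"
  assumes "connected A" "connected B" "connected C" "connected D"
    and "closed A" "closed B" "closed C" "closed D"
    and "A \<noteq> {}" "B \<noteq> {}" "C \<noteq> {}" "D \<noteq> {}"
    and "A \<inter> B = {}" "C \<inter> D = {}" "A \<union> B = C \<union> D"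
  shows "A = C \<and> B = D \<or> A = D \<and> B = C"
proof -
  have *: "S \<subseteq> X \<or> S \<subseteq> Y" if "connected S" "closed X" "closed Y" "X \<inter> Y = {}" "S \<subseteq> X \<union> Y" for S X Y :: "'a set"
    using connected_closedD[of S X Y] that by blast
  have A: "A \<subseteq> C \<or> A \<subseteq> D" by (rule *) (use assms in auto)
  have C: "C \<subseteq> A \<or> C \<subseteq> B" by (rule *) (use assms in auto)
  have D: "D \<subseteq> A \<or> D \<subseteq> B" by (rule *) (use assms in auto)
  have B: "B = (C \<union> D) - A" using assms(13,15) by blast
  from A show ?thesis
  proof
    assume "A \<subseteq> C"
    moreover from this have "C \<subseteq> A" using C assms(9,13) by blast
    ultimately have "A = C" by simp
    then show ?thesis using B assms(14) by blast
  next
    assume "A \<subseteq> D"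
    moreover from this have "D \<subseteq> A" using D assms(9,13) by blast
    ultimately have "A = D" by simp
    then show ?thesis using B assms(14) by blast
  qed
qed

lemma ambient_isotopy_preserves_linking:
  fixes H :: "real \<times> (nat \<Rightarrow> real) \<Rightarrow> nat \<Rightarrow> real"
  assumes H: "continuous_map (prod_topology (top_of_set {0..1}) S3) S3 H"
    and homeo: "\<And>t. t \<in> {0..1} \<Longrightarrow> homeomorphic_map S3 S3 (\<lambda>x. H (t, x))"
    and H0: "\<And>x. x \<in> topspace S3 \<Longrightarrow> H (0, x) = x"
  shows "preserves_linking (\<lambda>x. H (1, x))"
  unfolding preserves_linking_def
proof (intro allI impI, elim conjE)
  fix \<alpha> \<beta> assume a: "continuous_map (nsphere 1) S3 \<alpha>" and b: "continuous_map (nsphere 1) S3 \<beta>"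
    and d: "\<alpha> ` topspace (nsphere 1) \<inter> \<beta> ` topspace (nsphere 1) = {}"
  have S: "\<alpha> s \<in> topspace S3" "\<beta> s \<in> topspace S3" if "s \<in> topspace (nsphere 1)" for s
    using continuous_map_image_subset_topspace[OF a] continuous_map_image_subset_topspace[OF b] that by blast+
  have "linking_number \<alpha> \<beta> = linking_number (\<lambda>s. H (0, \<alpha> s)) (\<lambda>s. H (0, \<beta> s))"
    by (rule linking_number_cong) (simp_all add: S H0)
  also have "\<dots> = linking_number (\<lambda>s. H (1, \<alpha> s)) (\<lambda>s. H (1, \<beta> s))"
    by (rule linking_number_isotopy[OF H _ a b d]) (rule homeomorphic_imp_injective_map[OF homeo])
  finally show "linking_number ((\<lambda>x. H (1, x)) \<circ> \<alpha>) ((\<lambda>x. H (1, x)) \<circ> \<beta>) = linking_number \<alpha> \<beta>"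
    by (simp add: o_def)
qed

lemma Lk_ambient_isotopic:
  assumes L: "handlebody_link2 m n h1 h2" and L': "handlebody_link2 m' n' h1' h2'"
    and iso: "ambient_isotopic (h1 \<union> h2) (h1' \<union> h2')"
  shows "Lk h1 h2 = Lk h1' h2'"
proof -
  obtain H :: "real \<times> (nat \<Rightarrow> real) \<Rightarrow> nat \<Rightarrow> real" where
    H: "continuous_map (prod_topology (top_of_set {0..1}) S3) S3 H"
      "\<And>t. t \<in> {0..1} \<Longrightarrow> homeomorphic_map S3 S3 (\<lambda>x. H (t, x))"
      "\<And>x. x \<in> topspace S3 \<Longrightarrow> H (0, x) = x"
      "(\<lambda>x. H (1, x)) ` (h1 \<union> h2) = h1' \<union> h2'"
    using iso unfolding ambient_isotopic_def by blast
  define \<psi> where "\<psi> = (\<lambda>x. H (1, x))"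
  have \<psi>: "homeomorphic_map S3 S3 \<psi>" "preserves_linking \<psi>"
    using H(2)[of 1] ambient_isotopy_preserves_linking[OF H(1-3)] by (simp_all add: \<psi>_def)
  have hb: "handlebody m h1" "handlebody n h2" "h1 \<inter> h2 = {}"
      "handlebody m' h1'" "handlebody n' h2'" "h1' \<inter> h2' = {}"
    using L L' by (simp_all add: handlebody_link2_def)
  have h: "h1 \<subseteq> topspace S3" "h2 \<subseteq> topspace S3" using hb by (simp_all add: handlebody_def)
  note hb\<psi> = handlebody_image[OF \<psi>(1) hb(1)] handlebody_image[OF \<psi>(1) hb(2)]
  have "\<psi> ` h1 \<inter> \<psi> ` h2 = {}"
    using homeomorphic_imp_injective_map[OF \<psi>(1)] h hb(3) by (metis image_empty inj_on_image_Int)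
  moreover have "\<psi> ` h1 \<union> \<psi> ` h2 = h1' \<union> h2'" using H(4) by (simp add: \<psi>_def image_Un)
  ultimately have "\<psi> ` h1 = h1' \<and> \<psi> ` h2 = h2' \<or> \<psi> ` h1 = h2' \<and> \<psi> ` h2 = h1'"
    using hb(6) handlebody_topology[OF hb\<psi>(1)] handlebody_topology[OF hb\<psi>(2)]
      handlebody_topology[OF hb(4)] handlebody_topology[OF hb(5)]
    by (intro connected_components_unique) (auto intro: compact_imp_closed)
  then show ?thesis
    using Lk_image[OF \<psi> h hb(3)] Lk_commute[OF hb(6)] by auto
qed

theorem theorem2p2:
  fixes h1 h2 :: "(nat \<Rightarrow> real) set" and m n :: nat
  assumes "handlebody_link2 m n h1 h2"
  shows "(\<forall>e \<alpha> f \<beta> e' \<alpha>' f' \<beta>'.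
            represented_basis h1 m e \<alpha> \<and> represented_basis h2 n f \<beta> \<and>
            represented_basis h1 m e' \<alpha>' \<and> represented_basis h2 n f' \<beta>'
            \<longrightarrow> Lk_wrt m n \<alpha> \<beta> = Lk_wrt m n \<alpha>' \<beta>')
       \<and> (\<forall>m' n' h1' h2'.
            handlebody_link2 m' n' h1' h2' \<and> ambient_isotopic (h1 \<union> h2) (h1' \<union> h2')
            \<longrightarrow> Lk h1 h2 = Lk h1' h2')"
proof -
  have "h1 \<subseteq> topspace S3" "h2 \<subseteq> topspace S3" "h1 \<inter> h2 = {}"
    using assms by (simp_all add: handlebody_link2_def handlebody_def)
  note indep = Lk_wrt_basis_independent[OF this]
  show ?thesis
    by (intro conjI allI impI; elim conjE)
      (rule indep; assumption | rule Lk_ambient_isotopic[OF assms]; assumption)+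
qed

end
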